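(* Let $N\ge 1$, $0<\theta\le 2$ and $p>1$. Let $u$ be a solution of $\partial_t u+(-\Delta)^{\theta/2}u=u^p$ in $\mathbf{R}^N\times(0,T)$ (in the sense of the context), where $0<T<\infty$. Then there exists $\gamma>0$ depending only on $N$, $\theta$ and $p$ such that $$\sup_{x\in\mathbf{R}^N}\frac{1}{|B(x,(T-t)^{1/\theta})|}\int_{B(x,(T-t)^{1/\theta})}u(y,t)\,dy\le\gamma(T-t)^{-\frac{1}{p-1}}$$ for almost all $0<t<T$.
   Context: $B(x,r)=\{y\in\mathbf{R}^N:|x-y|<r\}$ and $|B(x,r)|$ is its volume. $G=G(x,t)$ denotes the fundamental solution of $\partial_t u+(-\Delta)^{\theta/2}u=0$ in $\mathbf{R}^N\times(0,\infty)$, i.e. the positive smooth kernel with $\int_{\mathbf{R}^N}G(x,t)e^{-i\xi\cdot x}\,dx=e^{-t|\xi|^\theta}$ (the Gauss kernel $(4\pi t)^{-N/2}e^{-|x|^2/4t}$ when $\theta=2$). A nonnegative measurable function $u$ in $\mathbf{R}^N\times(0,T)$, $0<T\le\infty$, is a solution of $\partial_t u+(-\Delta)^{\theta/2}u=u^p$ in $\mathbf{R}^N\times(0,T)$ if $$\infty>u(x,t)=\int_{\mathbf{R}^N}G(x-y,t-\tau)u(y,\tau)\,dy+\int_\tau^t\int_{\mathbf{R}^N}G(x-y,t-s)u(y,s)^p\,dy\,ds$$ for almost all $x\in\mathbf{R}^N$ and $0<\tau<t<T$. *)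

theory Defs
  imports "HOL-Analysis.Analysis"
begin

text \<open>\<open>higher_differentiable_on S f k\<close>: on the open set \<open>S\<close>, \<open>f\<close> is of class \<open>C\<^sup>k\<close>
  (all iterated directional derivatives up to order \<open>k\<close> exist and are continuous).\<close>

primrec higher_differentiable_on ::
  "'a::real_normed_vector set \<Rightarrow> ('a \<Rightarrow> 'b::real_normed_vector) \<Rightarrow> nat \<Rightarrow> bool" where
  "higher_differentiable_on S f 0 \<longleftrightarrow> continuous_on S f"
| "higher_differentiable_on S f (Suc k) \<longleftrightarrow>
     (\<forall>x\<in>S. f differentiable (at x)) \<and>
     (\<forall>v. higher_differentiable_on S (\<lambda>x. frechet_derivative f (at x) v) k)"

definition smooth_on ::
  "'a::real_normed_vector set \<Rightarrow> ('a \<Rightarrow> 'b::real_normed_vector) \<Rightarrow> bool" where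
  "smooth_on S f \<longleftrightarrow> (\<forall>k. higher_differentiable_on S f k)"

text \<open>The kernel is determined on \<open>t > 0\<close> by its Fourier transform and continuity; its values for
  \<open>t \<le> 0\<close> are unconstrained and never used below. Integrability is what makes the Fourier
  integral meaningful, as the Bochner integral of a non-integrable function is \<open>0\<close>.\<close>

definition fundamental_solution ::
  "real \<Rightarrow> (real ^ 'n \<Rightarrow> real \<Rightarrow> real) \<Rightarrow> bool" where
  "fundamental_solution \<theta> G \<longleftrightarrow>
     smooth_on (UNIV \<times> {0<..}) (\<lambda>(x, t). G x t) \<and>
     (\<forall>t>0. (\<forall>x. G x t > 0) \<and> integrable lborel (\<lambda>x. G x t) \<and>
       (\<forall>\<xi>. (LINT x|lborel. complex_of_real (G x t) * exp (- \<i> * complex_of_real (\<xi> \<bullet> x)))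
             = complex_of_real (exp (- t * norm \<xi> powr \<theta>))))"

text \<open>Real powers on \<open>[0, \<infinity>]\<close>, intended for exponents \<open>p > 0\<close>.\<close>

definition ennreal_powr :: "ennreal \<Rightarrow> real \<Rightarrow> ennreal" where
  "ennreal_powr a p = (if a = \<infinity> then \<infinity> else ennreal (enn2real a powr p))"

text \<open>Solutions are \<open>[0, \<infinity>]\<close>-valued and Lebesgue measurable; finiteness is only required almost
  everywhere. \<open>Almost all\<close> refers to Lebesgue measure on the space of triples \<open>(x, \<tau>, t)\<close>.
  Only the values of \<open>u\<close> at times in \<open>(0, T)\<close> matter.\<close>

definition is_solution ::
  "(real ^ 'n \<Rightarrow> real \<Rightarrow> real) \<Rightarrow> real \<Rightarrow> real \<Rightarrow> (real ^ 'n \<Rightarrow> real \<Rightarrow> ennreal) \<Rightarrow> bool" where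
  "is_solution G p T u \<longleftrightarrow>
     (\<lambda>(x, t). u x t) \<in> borel_measurable (lebesgue_on (UNIV \<times> {0<..<T})) \<and>
     (AE (x, \<tau>, t) in lebesgue. 0 < \<tau> \<and> \<tau> < t \<and> t < T \<longrightarrow>
        u x t < \<infinity> \<and>
        u x t =
          (\<integral>\<^sup>+ y. ennreal (G (x - y) (t - \<tau>)) * u y \<tau> \<partial>lebesgue) +
          (\<integral>\<^sup>+ s\<in>{\<tau><..<t}.
             (\<integral>\<^sup>+ y. ennreal (G (x - y) (t - s)) * ennreal_powr (u y s) p \<partial>lebesgue)
           \<partial>lebesgue))"

end

theory Submission
  imports Defs "HOL-Probability.Characteristic_Functions" "HOL-Real_Asymp.Real_Asymp"
begin

text \<open>
  Fix \<open>(x, t)\<close> and put \<open>w(s) = \<integral> G(x - y, t - s) u(y, s) dy\<close> for \<open>s < t\<close>. Applying the semigroup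
  \<open>G(t - s)\<close> to the integral equation on \<open>(\<tau>, s)\<close> and using Jensen's inequality gives
  \<open>w(s) \<ge> w(\<tau>) + \<integral>\<^sub>\<tau>\<^sup>s w(r)\<^sup>p dr\<close>. Since \<open>w(\<tau>) \<le> u(x, t) < \<infinity>\<close> almost everywhere, \<open>w\<close> does not blow
  up before \<open>t\<close>, which forces \<open>w(\<tau>) \<le> C (t - \<tau>)\<^bsup>-1/(p-1)\<^esup>\<close>. Taking \<open>(x, t)\<close> close to \<open>(x\<^sub>0, T)\<close> and
  bounding \<open>G\<close> from below on a parabolic neighbourhood gives the ball averages. The kernel has no
  closed form: its semigroup property and its self-similarity come from the injectivity of the
  Fourier transform.
\<close>

section \<open>Injectivity of the Fourier transform\<close>

lemma integral_lborel_prod: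
  fixes f :: "'a::euclidean_space \<Rightarrow> real \<Rightarrow> 'c::{real_normed_field, banach, second_countable_topology}"
  assumes f: "\<And>b. b \<in> Basis \<Longrightarrow> integrable lborel (f b)"
  shows integrable_lborel_prod: "integrable lborel (\<lambda>x. \<Prod>b\<in>Basis. f b (x \<bullet> b))" (is ?A)
    and "(LINT x|lborel. (\<Prod>b\<in>Basis. f b (x \<bullet> b))) = (\<Prod>b\<in>Basis. LINT x|lborel. f b x)" (is ?B)
proof -
  interpret product_sigma_finite "\<lambda>_::'a. lborel :: real measure" ..
  have [measurable]: "f b \<in> borel_measurable borel" if "b \<in> Basis" for b
    using borel_measurable_integrable[OF f[OF that]] by simp
  note * = product_integrable_prod[OF finite_Basis f] product_integral_prod[OF finite_Basis f]
  have eq: "(\<Prod>b\<in>Basis. f b ((\<Sum>b\<in>Basis. g b *\<^sub>R b) \<bullet> b)) = (\<Prod>b\<in>Basis. f b (g b))" for g :: "'a \<Rightarrow> real"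
    by (rule prod.cong) auto
  show ?A
    unfolding lborel_eq[where 'a='a] by (subst integrable_distr_eq) (auto simp: eq *)
  show ?B
    unfolding lborel_eq[where 'a='a] by (subst integral_distr) (auto simp: eq *)
qed

text \<open>Writes a Gaussian as a superposition of characters with the integrable weight
  \<open>\<Phi>\<close>. Everything factorises over coordinates, and each factor is the
  characteristic function of the standard normal law.\<close>

lemma fourier_gauss_product:
  fixes z :: "'a::euclidean_space"
  defines "\<Phi> \<equiv> \<lambda>\<xi>::'a. \<Prod>b\<in>Basis. std_normal_density (\<xi> \<bullet> b)"
  shows "integrable lborel \<Phi>"
    and "(CLINT \<xi>|lborel. \<Phi> \<xi> * iexp (\<xi> \<bullet> z)) = exp (- (norm z)\<^sup>2 / 2)"
proof -
  show "integrable lborel \<Phi>"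
    unfolding \<Phi>_def by (rule integrable_lborel_prod) simp
  define f :: "'a \<Rightarrow> real \<Rightarrow> complex" where "f b x = std_normal_density x * iexp ((z \<bullet> b) * x)" for b x
  have int: "integrable lborel (f b)" for b
    unfolding f_def
    by (rule Bochner_Integration.integrable_bound[of _ std_normal_density])
       (auto simp: norm_mult)
  have 1: "(LINT x|lborel. f b x) = exp (- (z \<bullet> b)\<^sup>2 / 2)" for b
    using fun_cong[OF char_std_normal_distribution, of "z \<bullet> b"]
    unfolding char_def f_def by (subst (asm) integral_density) (auto simp: scaleR_conv_of_real)
  have "(\<Prod>b\<in>Basis. f b (\<xi> \<bullet> b)) = \<Phi> \<xi> * iexp (\<xi> \<bullet> z)" for \<xi>
    unfolding f_def \<Phi>_def prod.distrib
    by (simp add: exp_sum[symmetric] euclidean_inner[of \<xi> z] sum_distrib_left mult_ac)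
  then have "(CLINT \<xi>|lborel. \<Phi> \<xi> * iexp (\<xi> \<bullet> z)) = (\<Prod>b\<in>Basis. complex_of_real (exp (- (z \<bullet> b)\<^sup>2 / 2)))"
    using integral_lborel_prod[of f] int 1 by simp
  also have "\<dots> = exp (- (norm z)\<^sup>2 / 2)"
    unfolding power2_norm_eq_inner
    by (simp add: euclidean_inner[of z z] of_real_prod[symmetric] exp_sum[symmetric] power2_eq_square sum_negf sum_divide_distrib del: of_real_prod)
  finally show "(CLINT \<xi>|lborel. \<Phi> \<xi> * iexp (\<xi> \<bullet> z)) = exp (- (norm z)\<^sup>2 / 2)" .
qed

text \<open>Expanding the Gaussian in characters and exchanging the integrals, with majorant
  \<open>\<bar>h y\<bar> * \<Phi> \<xi>\<close>, leaves the Fourier transform of \<open>h\<close> at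
  frequency \<open>s *\<^sub>R \<xi>\<close>.\<close>

lemma integral_gauss_eq_0_if_fourier_eq_0:
  fixes h :: "'a::euclidean_space \<Rightarrow> real"
  assumes h: "integrable lborel h"
    and F: "\<And>\<xi>. (CLINT x|lborel. h x * exp (- \<i> * (\<xi> \<bullet> x))) = 0"
  shows "(LINT y|lborel. h y * exp (- (norm (s *\<^sub>R (x - y)))\<^sup>2 / 2)) = 0"
proof -
  define \<Phi> where "\<Phi> = (\<lambda>\<xi>::'a. \<Prod>b\<in>Basis. std_normal_density (\<xi> \<bullet> b))"
  have \<Phi>: "integrable lborel \<Phi>" and \<Phi>0: "\<And>\<xi>. \<Phi> \<xi> \<ge> 0"
    and \<Phi>F: "\<And>z. (CLINT \<xi>|lborel. \<Phi> \<xi> * iexp (\<xi> \<bullet> z)) = exp (- (norm z)\<^sup>2 / 2)"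
    using fourier_gauss_product unfolding \<Phi>_def by (auto intro!: prod_nonneg)
  note [measurable] = borel_measurable_integrable[OF h] borel_measurable_integrable[OF \<Phi>]
  define k :: "'a \<Rightarrow> 'a \<Rightarrow> complex" where "k y \<xi> = h y * (\<Phi> \<xi> * iexp (\<xi> \<bullet> (s *\<^sub>R (x - y))))" for y \<xi>
  have nk: "norm (k y \<xi>) = \<bar>h y\<bar> * \<Phi> \<xi>" for y \<xi>
    by (simp add: k_def norm_mult \<Phi>0)
  have [measurable]: "(\<lambda>(y, \<xi>). k y \<xi>) \<in> borel_measurable (borel \<Otimes>\<^sub>M borel)"
    unfolding k_def by measurable
  have "integrable lborel (k y)" for y
    by (rule Bochner_Integration.integrable_bound[of _ "\<lambda>\<xi>. \<bar>h y\<bar> * \<Phi> \<xi>"])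
       (use \<Phi> in \<open>auto simp: \<Phi>0 abs_mult nk\<close>)
  then have ik: "integrable (lborel \<Otimes>\<^sub>M lborel) (\<lambda>(y, \<xi>). k y \<xi>)"
    by (intro lborel_pair.Fubini_integrable) (use h in \<open>auto simp: nk\<close>)
  have 1: "(CLINT y|lborel. k y \<xi>) = 0" for \<xi>
  proof -
    have "k y \<xi> = (\<Phi> \<xi> * iexp (\<xi> \<bullet> (s *\<^sub>R x))) * (h y * exp (- \<i> * ((s *\<^sub>R \<xi>) \<bullet> y)))" for y
      by (simp add: k_def inner_diff_right algebra_simps flip: exp_add)
    then show ?thesis
      using F[of "s *\<^sub>R \<xi>"] by (simp only: integral_mult_right_zero mult_zero_right)
  qed
  have 2: "(CLINT \<xi>|lborel. k y \<xi>) = complex_of_real (h y * exp (- (norm (s *\<^sub>R (x - y)))\<^sup>2 / 2))" for y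
    by (simp only: k_def integral_mult_right_zero \<Phi>F of_real_mult)
  have "(CLINT y|lborel. CLINT \<xi>|lborel. k y \<xi>) = (CLINT \<xi>|lborel. CLINT y|lborel. k y \<xi>)"
    using lborel_pair.Fubini_integral[OF ik] by simp
  then show ?thesis
    unfolding 1 2 integral_complex_of_real by simp
qed

text \<open>
  Testing against Gaussians of width \<open>1/s\<close> centred at \<open>x\<close>: as \<open>s \<rightarrow> \<infinity>\<close>, the ball contributes at
  least a multiple of \<open>s\<^bsup>-n\<^esup>\<close>, its complement at most a multiple of \<open>exp (-(s\<delta>)\<^sup>2/2)\<close>.
\<close>

lemma not_AE_ge_on_ball_if_fourier_eq_0:
  fixes h :: "'a::euclidean_space \<Rightarrow> real"
  assumes h: "integrable lborel h"
    and F: "\<And>\<xi>. (CLINT x|lborel. h x * exp (- \<i> * (\<xi> \<bullet> x))) = 0"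
    and c: "c > 0" and d: "\<delta> > 0" and ae: "AE y in lborel. y \<in> ball x \<delta> \<longrightarrow> c \<le> h y"
  shows False
proof -
  note [measurable] = borel_measurable_integrable[OF h]
  let ?n = "DIM('a)"
  define I where "I = (LINT y|lborel. \<bar>h y\<bar>)"
  define K where "K = c * exp (- 1 / 2) * unit_ball_vol ?n"
  have K: "K > 0" using c by (simp add: K_def)
  \<comment> \<open>The condition on \<open>s\<close> puts the ball of radius \<open>1 / s\<close>
    inside the one of radius \<open>\<delta>\<close>. On the small ball the Gaussian is at least
    \<open>exp (- 1 / 2)\<close>, which explains \<open>K\<close>; in the shell between the balls
    the integrand is nonnegative.\<close>
  have est: "K \<le> I * (s ^ ?n * exp (- (s * \<delta>)\<^sup>2 / 2))" if s: "s \<ge> 1 / \<delta>" for s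
  proof -
    have s0: "s > 0" using s d by (smt (verit) divide_pos_pos)
    have sd: "1 / s \<le> \<delta>" using s s0 d by (simp add: field_simps)
    define k where "k y = exp (- (norm (s *\<^sub>R (x - y)))\<^sup>2 / 2)" for y
    have k01: "0 \<le> k y" "k y \<le> 1" for y by (auto simp: k_def)
    have [measurable]: "k \<in> borel_measurable borel" by (simp add: k_def[abs_def])
    have ind: "integrable lborel (indicator (ball x (1 / s)) :: 'a \<Rightarrow> real)"
      using emeasure_lborel_ball_finite[of x "1 / s"] by (intro integrable_real_indicator) auto
    have "(LINT y|lborel. c * exp (- 1 / 2) * indicator (ball x (1 / s)) y - \<bar>h y\<bar> * exp (- (s * \<delta>)\<^sup>2 / 2))
        \<le> (LINT y|lborel. h y * k y)"
    proof (rule integral_mono_AE)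
      show "integrable lborel (\<lambda>y. c * exp (- 1 / 2) * indicator (ball x (1 / s)) y - \<bar>h y\<bar> * exp (- (s * \<delta>)\<^sup>2 / 2))"
        using h ind by (intro Bochner_Integration.integrable_diff integrable_mult_right integrable_mult_left) auto
      show "integrable lborel (\<lambda>y. h y * k y)"
        by (rule Bochner_Integration.integrable_bound[OF h])
          (use k01 in \<open>auto simp: abs_mult intro!: mult_left_le\<close>)
      show "AE y in lborel. c * exp (- 1 / 2) * indicator (ball x (1 / s)) y - \<bar>h y\<bar> * exp (- (s * \<delta>)\<^sup>2 / 2) \<le> h y * k y"
        using ae
      proof eventually_elim
        case (elim y)
        consider "y \<in> ball x (1 / s)" | "y \<in> ball x \<delta>" "y \<notin> ball x (1 / s)" | "y \<notin> ball x \<delta>" by blast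
        then show ?case
        proof cases
          case 1
          have "norm (s *\<^sub>R (x - y)) \<le> 1"
          proof -
            have "s * norm (x - y) < 1" using 1 s0 by (simp add: dist_norm field_simps)
            then show ?thesis using s0 by simp
          qed
          then have "(norm (s *\<^sub>R (x - y)))\<^sup>2 \<le> 1" by (simp add: abs_square_le_1)
          then have "exp (- 1 / 2) \<le> k y" by (simp add: k_def)
          moreover have "c \<le> h y" using elim 1 sd by auto
          ultimately have "c * exp (- 1 / 2) \<le> h y * k y"
            using c by (intro mult_mono) auto
          moreover have "0 \<le> \<bar>h y\<bar> * exp (- (s * \<delta>)\<^sup>2 / 2)" by simp
          moreover have "indicator (ball x (1 / s)) y = (1::real)" using 1 by simp
          ultimately show ?thesis by (simp only: mult_1_right; linarith)
        next
          case 2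
          then have "0 \<le> h y * k y" using elim c k01[of y] by auto
          moreover have "0 \<le> \<bar>h y\<bar> * exp (- (s * \<delta>)\<^sup>2 / 2)" by simp
          moreover have "indicator (ball x (1 / s)) y = (0::real)" using 2 by simp
          ultimately show ?thesis by (simp only: mult_zero_right; linarith)
        next
          case 3
          have "s * \<delta> \<le> norm (s *\<^sub>R (x - y))"
            using 3 s0 by (simp add: dist_norm)
          then have "(s * \<delta>)\<^sup>2 \<le> (norm (s *\<^sub>R (x - y)))\<^sup>2"
            using s0 d by (intro power_mono) auto
          then have "k y \<le> exp (- (s * \<delta>)\<^sup>2 / 2)" by (simp add: k_def)
          then have "\<bar>h y * k y\<bar> \<le> \<bar>h y\<bar> * exp (- (s * \<delta>)\<^sup>2 / 2)"
            using k01 by (simp add: abs_mult mult_left_mono)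
          moreover have "indicator (ball x (1 / s)) y = (0::real)" using 3 sd by auto
          ultimately show ?thesis by (simp only: mult_zero_right; linarith)
        qed
      qed
    qed
    also have "\<dots> = 0"
      unfolding k_def by (rule integral_gauss_eq_0_if_fourier_eq_0[OF h F])
    also have "(LINT y|lborel. c * exp (- 1 / 2) * indicator (ball x (1 / s)) y - \<bar>h y\<bar> * exp (- (s * \<delta>)\<^sup>2 / 2))
        = c * exp (- 1 / 2) * measure lborel (ball x (1 / s)) - I * exp (- (s * \<delta>)\<^sup>2 / 2)"
      using h ind by (subst Bochner_Integration.integral_diff) (auto simp: I_def)
    also have "c * exp (- 1 / 2) * measure lborel (ball x (1 / s)) = K / s ^ ?n"
      using s0 content_ball[of "1 / s" x] by (simp add: K_def power_divide)
    finally show ?thesis using s0 by (simp add: field_simps)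
  qed
  have "((\<lambda>s. I * (s ^ ?n * exp (- (s * \<delta>)\<^sup>2 / 2))) \<longlongrightarrow> I * 0) at_top"
    by (intro tendsto_mult_left) (use d in real_asymp)
  moreover have "eventually (\<lambda>s. K \<le> I * (s ^ ?n * exp (- (s * \<delta>)\<^sup>2 / 2))) at_top"
    using est by (rule eventually_at_top_linorderI)
  ultimately have "K \<le> I * 0"
    by (rule tendsto_lowerbound) simp
  then show False using K by simp
qed

lemma nn_integral_translate:
  fixes f :: "'a::euclidean_space \<Rightarrow> ennreal"
  assumes [measurable]: "f \<in> borel_measurable borel"
  shows "(\<integral>\<^sup>+ y. f (c + y) \<partial>lborel) = (\<integral>\<^sup>+ y. f y \<partial>lborel)"
    and "(\<integral>\<^sup>+ y. f (c - y) \<partial>lborel) = (\<integral>\<^sup>+ y. f y \<partial>lborel)"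
  using nn_integral_distr[of "\<lambda>x. c + x" lborel borel f] nn_integral_distr[of "\<lambda>x. c - x" lborel borel f]
    lborel_affine[of 1 c] lborel_affine[of "-1" c]
  by (simp_all add: density_1)

lemma integral_translate:
  fixes f :: "'a::euclidean_space \<Rightarrow> 'b::{banach, second_countable_topology}"
  assumes [measurable]: "f \<in> borel_measurable borel"
  shows "(LINT y|lborel. f (c + y)) = (LINT y|lborel. f y)"
  using integral_distr[of "\<lambda>x. c + x" lborel borel f] lborel_affine[of 1 c]
  by (simp add: density_1)

lemma integrable_mult_character:
  fixes h :: "'a::euclidean_space \<Rightarrow> real"
  assumes "integrable lborel h"
  shows "integrable lborel (\<lambda>x. h x * exp (- \<i> * (\<xi> \<bullet> x)))"
  by (rule Bochner_Integration.integrable_bound[OF assms])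
    (use borel_measurable_integrable[OF assms] in \<open>auto simp: norm_mult\<close>)

text \<open>If \<open>f x > g x\<close>, continuity keeps \<open>f - g\<close> above half the gap on
  a ball, which a vanishing transform of the difference excludes.\<close>

lemma continuous_eq_if_fourier_eq:
  fixes f g :: "'a::euclidean_space \<Rightarrow> real"
  assumes f: "integrable lborel f" "continuous_on UNIV f" and g: "integrable lborel g" "continuous_on UNIV g"
    and F: "\<And>\<xi>. (CLINT x|lborel. f x * exp (- \<i> * (\<xi> \<bullet> x))) = (CLINT x|lborel. g x * exp (- \<i> * (\<xi> \<bullet> x)))"
  shows "f = g"
proof -
  have le: "f x \<le> g x" if f: "integrable lborel f" "continuous_on UNIV f" and g: "integrable lborel g" "continuous_on UNIV g"
    and F: "\<And>\<xi>. (CLINT x|lborel. f x * exp (- \<i> * (\<xi> \<bullet> x))) = (CLINT x|lborel. g x * exp (- \<i> * (\<xi> \<bullet> x)))"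
    for f g :: "'a \<Rightarrow> real" and x
  proof (rule ccontr)
    assume "\<not> f x \<le> g x"
    define c where "c = (f x - g x) / 2"
    have c: "c > 0" "f x - g x > c" using \<open>\<not> f x \<le> g x\<close> by (auto simp: c_def field_simps)
    have "open {y. c < f y - g y}"
      using f g by (intro open_Collect_less continuous_intros)
    then obtain \<delta> where d: "\<delta> > 0" "ball x \<delta> \<subseteq> {y. c < f y - g y}"
      using c by (auto elim!: openE)
    show False
    proof (rule not_AE_ge_on_ball_if_fourier_eq_0[OF _ _ c(1) d(1)])
      show "integrable lborel (\<lambda>x. f x - g x)" using f g by simp
      show "(CLINT x|lborel. (f x - g x) * exp (- \<i> * (\<xi> \<bullet> x))) = 0" for \<xi>
        using F[of \<xi>] integrable_mult_character[OF f(1)] integrable_mult_character[OF g(1)] by (simp add: left_diff_distrib)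
      show "AE y in lborel. y \<in> ball x \<delta> \<longrightarrow> c \<le> f y - g y"
        using d(2) by (intro AE_I2) (auto simp: subset_eq intro: less_imp_le)
    qed
  qed
  show ?thesis
    using le[OF f g F] le[OF g f F[symmetric]] by (intro ext antisym)
qed

text \<open>The character at \<open>x\<close> is the product of those at \<open>x - y\<close> and at
  \<open>y\<close>, so Fubini separates the factors. The middle claim says where \<open>c x\<close>
  is a genuine integral and not the default value 0.\<close>

lemma fourier_convolution:
  fixes f g :: "'a::euclidean_space \<Rightarrow> real"
  assumes f: "integrable lborel f" and g: "integrable lborel g"
  defines "c \<equiv> \<lambda>x. LINT y|lborel. f (x - y) * g y"
  shows "integrable lborel c"
    and "AE x in lborel. integrable lborel (\<lambda>y. f (x - y) * g y)"
    and "(CLINT x|lborel. c x * exp (- \<i> * (\<xi> \<bullet> x))) =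
      (CLINT x|lborel. f x * exp (- \<i> * (\<xi> \<bullet> x))) * (CLINT x|lborel. g x * exp (- \<i> * (\<xi> \<bullet> x)))"
proof -
  note [measurable] = borel_measurable_integrable[OF f] borel_measurable_integrable[OF g]
  have shift: "integrable lborel (\<lambda>x. f (x - y))" for y
  proof -
    have "integrable (distr lborel borel (\<lambda>x. - y + x)) f"
      using f lborel_affine[of 1 "- y"] by (simp add: density_1)
    then show ?thesis by (subst (asm) integrable_distr_eq) auto
  qed
  have "integrable (lborel \<Otimes>\<^sub>M lborel) (\<lambda>(y, x). f (x - y) * g y)"
  proof (rule lborel_pair.Fubini_integrable)
    have "(LINT x|lborel. norm (f (x - y) * g y)) = (LINT x|lborel. \<bar>f x\<bar>) * \<bar>g y\<bar>" for y
      using integral_translate[of "\<lambda>x. \<bar>f x\<bar>" "- y"] by (simp add: abs_mult)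
    then show "integrable lborel (\<lambda>y. LINT x|lborel. norm (case (y, x) of (y, x) \<Rightarrow> f (x - y) * g y))"
      using g by simp
  qed (use shift in auto)
  from lborel_pair.integrable_product_swap[OF this]
  have int: "integrable (lborel \<Otimes>\<^sub>M lborel) (\<lambda>(x, y). f (x - y) * g y)"
    by (simp add: split_def)
  show "integrable lborel c"
    using lborel_pair.integrable_fst'[OF int] by (simp add: c_def)
  show "AE x in lborel. integrable lborel (\<lambda>y. f (x - y) * g y)"
    using lborel_pair.AE_integrable_fst'[OF int] by simp
  define k :: "'a \<Rightarrow> 'a \<Rightarrow> complex"
    where "k x y = (f (x - y) * exp (- \<i> * (\<xi> \<bullet> (x - y)))) * (g y * exp (- \<i> * (\<xi> \<bullet> y)))" for x y
  have k: "k x y = complex_of_real (f (x - y) * g y) * exp (- \<i> * (\<xi> \<bullet> x))" for x y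
    by (simp add: k_def inner_diff_right algebra_simps flip: exp_add)
  have ik: "integrable (lborel \<Otimes>\<^sub>M lborel) (\<lambda>(x, y). k x y)"
    by (rule Bochner_Integration.integrable_bound[OF int]) (auto simp: k norm_mult split_def)
  have 1: "(CLINT y|lborel. k x y) = c x * exp (- \<i> * (\<xi> \<bullet> x))" for x
    unfolding k c_def by (simp only: integral_mult_left_zero integral_complex_of_real)
  have 2: "(CLINT x|lborel. k x y) = (CLINT x|lborel. f x * exp (- \<i> * (\<xi> \<bullet> x))) * (g y * exp (- \<i> * (\<xi> \<bullet> y)))" for y
    using integral_translate[of "\<lambda>x. f x * exp (- \<i> * (\<xi> \<bullet> x))" "- y"]
    unfolding k_def integral_mult_left_zero by simp
  have "(CLINT x|lborel. CLINT y|lborel. k x y) = (CLINT y|lborel. CLINT x|lborel. k x y)"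
    using lborel_pair.Fubini_integral[OF ik] by simp
  then show "(CLINT x|lborel. c x * exp (- \<i> * (\<xi> \<bullet> x))) =
      (CLINT x|lborel. f x * exp (- \<i> * (\<xi> \<bullet> x))) * (CLINT x|lborel. g x * exp (- \<i> * (\<xi> \<bullet> x)))"
    unfolding 1 2 integral_mult_right_zero .
qed

lemma fourier_scaling:
  fixes f :: "'a::euclidean_space \<Rightarrow> real"
  assumes l: "l > 0" and f: "integrable lborel f"
  shows "integrable lborel (\<lambda>x. l ^ DIM('a) * f (l *\<^sub>R x))"
    and "(CLINT x|lborel. (l ^ DIM('a) * f (l *\<^sub>R x)) * exp (- \<i> * (\<xi> \<bullet> x))) =
      (CLINT x|lborel. f x * exp (- \<i> * ((\<xi> /\<^sub>R l) \<bullet> x)))"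
proof -
  note [measurable] = borel_measurable_integrable[OF f]
  have eq: "lborel = density (distr lborel borel (\<lambda>x::'a. l *\<^sub>R x)) (\<lambda>_. l ^ DIM('a))"
    using lborel_affine[of l "0::'a"] l by simp
  show "integrable lborel (\<lambda>x. l ^ DIM('a) * f (l *\<^sub>R x))"
    using f l by (subst (asm) eq) (simp add: integrable_density integrable_distr_eq)
  have int: "(CLINT x|lborel. f x * exp (- \<i> * ((\<xi> /\<^sub>R l) \<bullet> x))) =
    (CLINT x|lborel. l ^ DIM('a) *\<^sub>R (f (l *\<^sub>R x) * exp (- \<i> * ((\<xi> /\<^sub>R l) \<bullet> (l *\<^sub>R x)))))"
    using l by (subst eq) (simp add: integral_density integral_distr mult_ac)
  show "(CLINT x|lborel. (l ^ DIM('a) * f (l *\<^sub>R x)) * exp (- \<i> * (\<xi> \<bullet> x))) =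
      (CLINT x|lborel. f x * exp (- \<i> * ((\<xi> /\<^sub>R l) \<bullet> x)))"
  proof -
    have 1: "(\<xi> /\<^sub>R l) \<bullet> (l *\<^sub>R x) = \<xi> \<bullet> x" for x using l by simp
    show ?thesis
      unfolding int 1 scaleR_conv_of_real by (simp add: mult.assoc)
  qed
qed

text \<open>Fatou's lemma along a sequence tending to \<open>x\<close>. Continuity would require a
  common majorant for the translates; Fatou does not.\<close>

lemma convolution_lower_semicontinuous:
  fixes f g :: "'a::euclidean_space \<Rightarrow> real"
  assumes f: "continuous_on UNIV f" and [measurable]: "g \<in> borel_measurable borel"
    and c: "c < (\<integral>\<^sup>+ y. ennreal (f (x - y) * g y) \<partial>lborel)"
  obtains \<delta> where "\<delta> > 0" "\<And>w. w \<in> ball x \<delta> \<Longrightarrow> c < (\<integral>\<^sup>+ y. ennreal (f (w - y) * g y) \<partial>lborel)"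
proof -
  have [measurable]: "f \<in> borel_measurable borel"
    using f by (rule borel_measurable_continuous_onI)
  have "\<exists>\<delta>>0. \<forall>w\<in>ball x \<delta>. c < (\<integral>\<^sup>+ y. ennreal (f (w - y) * g y) \<partial>lborel)"
  proof (rule ccontr)
    assume "\<not> ?thesis"
    then have "\<forall>n. \<exists>w. dist x w < 1 / real (Suc n) \<and> (\<integral>\<^sup>+ y. ennreal (f (w - y) * g y) \<partial>lborel) \<le> c"
      by (force simp: not_less)
    then obtain W where W: "\<And>n. dist x (W n) < 1 / real (Suc n)"
      "\<And>n. (\<integral>\<^sup>+ y. ennreal (f (W n - y) * g y) \<partial>lborel) \<le> c" by metis
    have "(\<lambda>n. dist x (W n)) \<longlonglongrightarrow> 0"
      by (rule tendsto_sandwich[OF _ _ tendsto_const LIMSEQ_inverse_real_of_nat])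
        (use W(1) in \<open>auto simp: inverse_eq_divide less_imp_le\<close>)
    then have lim: "W \<longlonglongrightarrow> x"
      by (simp add: tendsto_dist_iff[of W] dist_commute)
    have "(\<lambda>n. ennreal (f (W n - y) * g y)) \<longlonglongrightarrow> ennreal (f (x - y) * g y)" for y
    proof -
      have "(\<lambda>n. f (W n - y)) \<longlonglongrightarrow> f (x - y)"
        by (rule continuous_on_tendsto_compose[OF f]) (auto intro!: tendsto_intros lim)
      then show ?thesis by (intro tendsto_ennrealI tendsto_mult_right)
    qed
    then have "liminf (\<lambda>n. ennreal (f (W n - y) * g y)) = ennreal (f (x - y) * g y)" for y
      by (intro lim_imp_Liminf) auto
    then have "(\<integral>\<^sup>+ y. ennreal (f (x - y) * g y) \<partial>lborel) \<le> liminf (\<lambda>n. \<integral>\<^sup>+ y. ennreal (f (W n - y) * g y) \<partial>lborel)"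
      using nn_integral_liminf[of "\<lambda>n y. ennreal (f (W n - y) * g y)" lborel] by simp
    also have "\<dots> \<le> c"
      using W(2) by (intro Liminf_le) (auto)
    finally show False using c by simp
  qed
  then show thesis using that by blast
qed

section \<open>The differential inequality and Jensen's inequality\<close>

text \<open>Nonempty open sets have positive measure. This turns almost everywhere statements into
  actual choices of times and points.\<close>

lemma AE_lborel_open_ex:
  fixes U :: "'a::euclidean_space set"
  assumes "AE x in lborel. P x" "open U" "U \<noteq> {}"
  obtains x where "x \<in> U" "P x"
proof -
  have "\<not> (AE x in lborel. x \<notin> U)"
  proof
    assume "AE x in lborel. x \<notin> U"
    then have "AE x in lebesgue. x \<notin> U" by (rule AE_completion)
    then have "negligible U"
      by (simp add: negligible_iff_null_sets AE_iff_null_sets assms(2) borel_open sets_completionI_sets)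
    then show False using open_not_negligible assms by blast
  qed
  then show thesis using assms(1) that by (smt (verit) eventually_mono)
qed

text \<open>
  Starting from \<open>F \<tau> \<ge> a\<close>, the value doubles from \<open>2\<^sup>k a\<close> within time \<open>(2\<^sup>k a)\<^bsup>1-p\<^esup>\<close>; these times sum to
  \<open>a\<^bsup>1-p\<^esup> / (1 - 2\<^bsup>1-p\<^esup>)\<close>, so \<open>F\<close> would be unbounded before \<open>t\<close> if \<open>a\<close> were too large.
\<close>

lemma power_growth_bound:
  fixes F :: "real \<Rightarrow> real"
  assumes p: "p > 1" and a: "a > 0" "F \<tau> \<ge> a" and t: "\<tau> < t"
    and step: "\<And>s h. \<lbrakk>\<tau> \<le> s; h > 0; s + h < t\<rbrakk> \<Longrightarrow> F (s + h) \<ge> F s + h * F s powr p"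
  shows "a \<le> ((1 - 2 powr (1 - p)) * (t - \<tau>)) powr (- 1 / (p - 1))"
proof (rule ccontr)
  define q :: real where "q = 2 powr (1 - p)"
  have q: "0 < q" "q < 1" using p by (auto simp: q_def intro: powr_less_one)
  define S where "S = a powr (1 - p) / (1 - q)"
  assume "\<not> a \<le> ((1 - 2 powr (1 - p)) * (t - \<tau>)) powr (- 1 / (p - 1))"
  then have "((1 - q) * (t - \<tau>)) powr (- 1 / (p - 1)) < a" by (simp add: q_def)
  \<comment> \<open>The negative exponent \<open>1 - p\<close> reverses the inequality. The negated
    claim thus says that the total doubling time \<open>S\<close> fits before
    \<open>t\<close>.\<close>
  then have "a powr (1 - p) < (((1 - q) * (t - \<tau>)) powr (- 1 / (p - 1))) powr (1 - p)"
    using q t p by (intro powr_less_mono2_neg) auto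
  also have "\<dots> = (1 - q) * (t - \<tau>)"
  proof -
    have "- 1 / (p - 1) * (1 - p) = 1" using p by (simp add: field_simps)
    then show ?thesis using q t by (simp add: powr_powr del: times_divide_eq_left)
  qed
  finally have S: "\<tau> + S < t" using q by (simp add: S_def field_simps)
  define h where "h k = a powr (1 - p) * q ^ k" for k
  define s where "s k = \<tau> + (\<Sum>i<k. h i)" for k
  have h0: "h k > 0" for k using a q by (simp add: h_def)
  have s_lt: "s k < \<tau> + S" for k
  proof -
    have "(\<Sum>i<k. h i) = a powr (1 - p) * ((1 - q ^ k) / (1 - q))"
      using q by (simp add: h_def sum_distrib_left[symmetric] sum_gp_strict)
    also have "\<dots> < S" using q a by (simp add: S_def divide_strict_right_mono)
    finally show ?thesis by (simp add: s_def)
  qed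
  have s_ge: "s k \<ge> \<tau>" for k using h0 by (simp add: s_def sum_nonneg less_imp_le)
  have grow: "F (s k) \<ge> 2 ^ k * a" for k
  proof (induction k)
    case 0 then show ?case using a by (simp add: s_def)
  next
    case (Suc k)
    \<comment> \<open>With this length, a step from height \<open>2 ^ k * a\<close> gains at least
      that height again.\<close>
    have "h k = (2 ^ k * a) powr (1 - p)"
      using a by (simp add: h_def q_def powr_mult powr_powr mult.commute flip: powr_realpow)
    then have "2 ^ k * a = h k * (2 ^ k * a) powr p"
      using a by (simp flip: powr_add)
    also have "\<dots> \<le> h k * F (s k) powr p"
      using Suc a p h0[of k] by (intro mult_left_mono powr_mono2) auto
    finally have "2 ^ k * a \<le> h k * F (s k) powr p" .
    moreover have "F (s k + h k) \<ge> F (s k) + h k * F (s k) powr p"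
      using s_lt[of "Suc k"] S by (intro step s_ge h0) (simp add: s_def)
    ultimately show ?case using Suc by (simp add: s_def add.assoc)
  qed
  \<comment> \<open>One last step from \<open>s k\<close> reaches the fixed time
    \<open>\<tau> + S\<close>, still before \<open>t\<close>, where \<open>F\<close> then exceeds
    every power of 2 times \<open>a\<close>.\<close>
  have "2 ^ k * a \<le> F (\<tau> + S)" for k
  proof -
    have "F (s k) + (\<tau> + S - s k) * F (s k) powr p \<le> F (s k + (\<tau> + S - s k))"
      using s_lt[of k] s_ge[of k] S by (intro step) auto
    moreover have "0 \<le> (\<tau> + S - s k) * F (s k) powr p"
      using s_lt[of k] by (intro mult_nonneg_nonneg) auto
    ultimately show ?thesis using grow[of k] by simp
  qed
  moreover obtain k where "F (\<tau> + S) / a < 2 ^ k"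
    using real_arch_pow[of 2] by auto
  ultimately show False using a by (simp add: field_simps not_le[symmetric])
qed

lemma ennreal_powr_mono: "0 \<le> p \<Longrightarrow> a \<le> b \<Longrightarrow> ennreal_powr a p \<le> ennreal_powr b p"
  by (cases a; cases b) (auto simp: ennreal_powr_def powr_mono2 enn2real_mono top_unique intro!: ennreal_leI)

lemma measurable_ennreal_powr [measurable]: "(\<lambda>a. ennreal_powr a p) \<in> borel_measurable borel"
  unfolding ennreal_powr_def by measurable

text \<open>The inequality for \<open>w\<close> holds only almost everywhere, so \<open>w\<close> is
  replaced by its lower bound \<open>E\<close>. This is defined everywhere, nondecreasing, and at
  most \<open>w\<close> almost everywhere between \<open>\<tau>\<close> and \<open>t\<close>, which
  gives the increments that \<open>power_growth_bound\<close> requires.\<close>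

lemma integral_inequality_bound:
  fixes w :: "real \<Rightarrow> ennreal"
  assumes p: "p > 1" and t: "\<tau> < t" and [measurable]: "w \<in> borel_measurable borel"
    and w: "AE s in lborel. \<tau> < s \<and> s < t \<longrightarrow>
       w s < \<infinity> \<and> a + (\<integral>\<^sup>+ r\<in>{\<tau><..<s}. ennreal_powr (w r) p \<partial>lborel) \<le> w s"
  shows "a \<le> ennreal (((1 - 2 powr (1 - p)) * (t - \<tau>)) powr (- 1 / (p - 1)))"
proof (cases "a = 0")
  case False
  define E where "E s = a + (\<integral>\<^sup>+ r\<in>{\<tau><..<s}. ennreal_powr (w r) p \<partial>lborel)" for s
  have E_mono: "E s \<le> E s'" if "s \<le> s'" for s s'
    unfolding E_def using that
    by (intro add_left_mono nn_integral_mono) (auto simp: indicator_def)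
  \<comment> \<open>Monotonicity bounds \<open>E s\<close> by the finite value of \<open>w\<close>
    at some later good time before \<open>t\<close>.\<close>
  have E_fin: "E s < \<infinity>" if "s < t" for s
  proof -
    have "open {max s \<tau><..<t}" "{max s \<tau><..<t} \<noteq> {}" using that t by auto
    from AE_lborel_open_ex[OF w this] obtain s' where "max s \<tau> < s'" "s' < t" "E s' \<le> w s'" "w s' < \<infinity>"
      unfolding E_def by auto
    then show ?thesis using E_mono[of s s'] by (auto intro: le_less_trans)
  qed
  have E_step: "E s + ennreal h * ennreal_powr (E s) p \<le> E (s + h)"
    if s: "\<tau> \<le> s" "h > 0" "s + h < t" for s h
  proof -
    have "ennreal h * ennreal_powr (E s) p = (\<integral>\<^sup>+ r\<in>{s<..<s + h}. ennreal_powr (E s) p \<partial>lborel)"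
      using s by (simp add: nn_integral_cmult_indicator mult.commute)
    also have "\<dots> \<le> (\<integral>\<^sup>+ r\<in>{s<..<s + h}. ennreal_powr (w r) p \<partial>lborel)"
    proof (rule nn_integral_mono_AE, use w in eventually_elim)
      case (elim r)
      show ?case
      proof (cases "r \<in> {s<..<s + h}")
        case True
        then have "E r \<le> w r" using elim s by (auto simp: E_def)
        moreover have "E s \<le> E r" using E_mono True by auto
        ultimately show ?thesis using p by (intro mult_right_mono ennreal_powr_mono) auto
      qed auto
    qed
    finally have "E s + ennreal h * ennreal_powr (E s) p \<le> a + ((\<integral>\<^sup>+ r\<in>{\<tau><..<s}. ennreal_powr (w r) p \<partial>lborel) +
        (\<integral>\<^sup>+ r\<in>{s<..<s + h}. ennreal_powr (w r) p \<partial>lborel))"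
      unfolding E_def add.assoc by (intro add_left_mono)
    also have "\<dots> \<le> E (s + h)"
      unfolding E_def using s
      by (subst nn_integral_add[symmetric])
        (auto intro!: add_left_mono nn_integral_mono simp: indicator_def)
    finally show ?thesis .
  qed
  define F where "F s = enn2real (E s)" for s
  have EF: "E s = ennreal (F s)" if "s < t" for s
    using E_fin[OF that] by (simp add: F_def)
  have F0: "F s \<ge> 0" for s by (simp add: F_def)
  have "a < \<infinity>" using E_fin[OF t] by (simp add: E_def)
  then obtain b where b: "a = ennreal b" "b > 0"
    using False by (cases a) (auto simp: less_le)
  have "b \<le> ((1 - 2 powr (1 - p)) * (t - \<tau>)) powr (- 1 / (p - 1))"
  proof (rule power_growth_bound[OF p b(2) _ t])
    show "b \<le> F \<tau>" using EF[OF t] b F0[of \<tau>] by (simp add: E_def)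
    show "F s + h * F s powr p \<le> F (s + h)" if "\<tau> \<le> s" "h > 0" "s + h < t" for s h
      using E_step[OF that] that F0[of s] F0[of "s + h"] EF[of s] EF[of "s + h"]
      by (simp add: ennreal_powr_def flip: ennreal_mult ennreal_plus)
  qed
  then show ?thesis using b by (simp add: ennreal_leI)
qed simp

text \<open>The fact \<open>young\<close> is the tangent line inequality for the \<open>p\<close>-th
  power at the mean \<open>m\<close>, obtained from Young's inequality with exponents
  \<open>p\<close> and \<open>p / (p - 1)\<close>. It is integrated against the density
  \<open>g\<close>, and the finite constant \<open>(p - 1) * m powr p\<close> is cancelled; the
  right side may be infinite.\<close>

lemma jensen_ennreal_powr:
  fixes f g :: "'a \<Rightarrow> ennreal"
  assumes p: "p > 1" and [measurable]: "f \<in> borel_measurable M" "g \<in> borel_measurable M"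
    and g: "(\<integral>\<^sup>+ x. g x \<partial>M) = 1" and fin: "(\<integral>\<^sup>+ x. g x * f x \<partial>M) < \<infinity>"
  shows "ennreal_powr (\<integral>\<^sup>+ x. g x * f x \<partial>M) p \<le> (\<integral>\<^sup>+ x. g x * ennreal_powr (f x) p \<partial>M)"
proof -
  obtain m where m: "(\<integral>\<^sup>+ x. g x * f x \<partial>M) = ennreal m" "m \<ge> 0"
    using fin by (cases "\<integral>\<^sup>+ x. g x * f x \<partial>M") auto
  have young: "ennreal (p * m powr (p - 1)) * a \<le> ennreal_powr a p + ennreal ((p - 1) * m powr p)" for a
  proof (cases a)
    case (real b)
    define q where "q = p / (p - 1)"
    have q: "q > 1" "1 / p + 1 / q = 1" using p by (auto simp: q_def field_simps)
    have "b * m powr (p - 1) \<le> b powr p / p + (m powr (p - 1)) powr q / q"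
      using q p real m by (intro Youngs_inequality) auto
    also have "(m powr (p - 1)) powr q = m powr p"
      using p by (simp add: powr_powr q_def)
    finally have "p * m powr (p - 1) * b \<le> b powr p + (p - 1) * m powr p"
      using p by (simp add: q_def field_simps)
    then show ?thesis
      using real p by (simp add: ennreal_powr_def ennreal_leI flip: ennreal_mult ennreal_plus)
  qed (auto simp: ennreal_powr_def)
  have "ennreal (p * m powr p) = ennreal (p * m powr (p - 1)) * ennreal m"
    using m p by (cases "m = 0") (auto simp: powr_diff simp flip: ennreal_mult)
  also have "\<dots> = (\<integral>\<^sup>+ x. g x * (ennreal (p * m powr (p - 1)) * f x) \<partial>M)"
    unfolding m(1)[symmetric] by (simp add: nn_integral_cmult[symmetric] mult_ac)
  also have "\<dots> \<le> (\<integral>\<^sup>+ x. g x * (ennreal_powr (f x) p + ennreal ((p - 1) * m powr p)) \<partial>M)"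
    by (intro nn_integral_mono mult_left_mono young) simp
  also have "\<dots> = (\<integral>\<^sup>+ x. g x * ennreal_powr (f x) p \<partial>M) + ennreal ((p - 1) * m powr p)"
    by (simp add: distrib_left nn_integral_add nn_integral_multc g)
  finally have "ennreal (p * m powr p) \<le> (\<integral>\<^sup>+ x. g x * ennreal_powr (f x) p \<partial>M) + ennreal ((p - 1) * m powr p)" .
  moreover have "ennreal (p * m powr p) = ennreal (m powr p) + ennreal ((p - 1) * m powr p)"
    using p mult_right_mono[of 1 p "m powr p"] by (subst ennreal_plus[symmetric]) (auto simp: algebra_simps)
  ultimately have "ennreal ((p - 1) * m powr p) + ennreal (m powr p)
      \<le> ennreal ((p - 1) * m powr p) + (\<integral>\<^sup>+ x. g x * ennreal_powr (f x) p \<partial>M)"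
    by (simp only: add.commute)
  then have "ennreal (m powr p) \<le> (\<integral>\<^sup>+ x. g x * ennreal_powr (f x) p \<partial>M)"
    unfolding ennreal_add_left_cancel_le by simp
  then show ?thesis using m by (simp add: ennreal_powr_def)
qed

section \<open>The fundamental solution\<close>

context
  fixes \<theta> :: real and G :: "real ^ 'n \<Rightarrow> real \<Rightarrow> real"
  assumes G: "fundamental_solution \<theta> G"
begin

lemma kernel_continuous: "continuous_on (UNIV \<times> {0<..}) (\<lambda>(x, t). G x t)"
proof -
  have "higher_differentiable_on (UNIV \<times> {0<..}) (\<lambda>(x, t). G x t) 0"
    using G unfolding fundamental_solution_def smooth_on_def by blast
  then show ?thesis by simp
qed

lemma kernel_pos: "t > 0 \<Longrightarrow> G x t > 0"
  and kernel_integrable: "t > 0 \<Longrightarrow> integrable lborel (\<lambda>x. G x t)"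
  and kernel_fourier: "t > 0 \<Longrightarrow> (CLINT x|lborel. G x t * exp (- \<i> * (\<xi> \<bullet> x))) = exp (- t * norm \<xi> powr \<theta>)"
  using G unfolding fundamental_solution_def by blast+

lemma kernel_continuous_slice: "t > 0 \<Longrightarrow> continuous_on UNIV (\<lambda>x. G x t)"
  using continuous_on_compose2[OF kernel_continuous, of UNIV "\<lambda>x. (x, t)"]
  by (simp add: continuous_on_Pair image_subset_iff)

lemma kernel_measurable: "t > 0 \<Longrightarrow> (\<lambda>x. G x t) \<in> borel_measurable borel"
  by (intro borel_measurable_continuous_onI kernel_continuous_slice)

lemma kernel_nn_integral:
  assumes "t > 0"
  shows "(\<integral>\<^sup>+ x. ennreal (G x t) \<partial>lborel) = 1"
proof -
  \<comment> \<open>At frequency 0 the exponent vanishes, since \<open>0 powr \<theta>\<close> is 0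
    for every \<open>\<theta>\<close>.\<close>
  have "(CLINT x|lborel. complex_of_real (G x t)) = complex_of_real 1"
    using kernel_fourier[OF assms, of 0] by simp
  then have "(LINT x|lborel. G x t) = 1"
    unfolding integral_complex_of_real of_real_eq_iff .
  then show ?thesis
    using nn_integral_eq_integral[OF kernel_integrable[OF assms]] kernel_pos[OF assms]
    by (simp add: less_imp_le)
qed

text \<open>
  The convolution is only known to be lower semicontinuous, so the Fourier argument yields
  one inequality everywhere; equality almost everywhere then follows from equal total mass.
\<close>

lemma kernel_convolution_le:
  assumes a: "a > 0" and b: "b > 0"
  shows "(\<integral>\<^sup>+ y. ennreal (G (x - y) a * G y b) \<partial>lborel) \<le> ennreal (G x (a + b))"
proof (rule ccontr)
  have ab: "a + b > 0" using a b by simp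
  define c where "c x = (LINT y|lborel. G (x - y) a * G y b)" for x
  note conv = fourier_convolution[OF kernel_integrable[OF a] kernel_integrable[OF b], folded c_def]
  assume "\<not> ?thesis"
  then obtain m where m: "ennreal (G x (a + b)) < m" "m < (\<integral>\<^sup>+ y. ennreal (G (x - y) a * G y b) \<partial>lborel)"
    using dense by (auto simp: not_le)
  then obtain r where r: "m = ennreal r" "r \<ge> 0" by (cases m) auto
  have r': "G x (a + b) < r" using m(1) r kernel_pos[OF ab, of x] by (simp add: ennreal_less_iff)
  \<comment> \<open>Near \<open>x\<close> the kernel stays below \<open>s\<close> by continuity and
    the convolution above \<open>r\<close> by lower semicontinuity. The difference is then at least
    \<open>r - s\<close> on a ball although its transform vanishes.\<close>
  define s where "s = (G x (a + b) + r) / 2"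
  have s: "G x (a + b) < s" "s < r" using r' by (auto simp: s_def)
  obtain d where d: "d > 0" "\<And>w. w \<in> ball x d \<Longrightarrow> m < (\<integral>\<^sup>+ y. ennreal (G (w - y) a * G y b) \<partial>lborel)"
    using convolution_lower_semicontinuous[OF kernel_continuous_slice[OF a] kernel_measurable[OF b] m(2)] by blast
  have "open {y. G y (a + b) < s}"
    using kernel_continuous_slice[OF ab] by (intro open_Collect_less continuous_intros)
  then obtain e where e: "e > 0" "\<And>w. w \<in> ball x e \<Longrightarrow> G w (a + b) < s"
    using s by (auto elim!: openE simp: subset_eq)
  show False
  proof (rule not_AE_ge_on_ball_if_fourier_eq_0)
    show "integrable lborel (\<lambda>x. c x - G x (a + b))"
      using conv(1) kernel_integrable[OF ab] by simp
    show "(CLINT x|lborel. (c x - G x (a + b)) * exp (- \<i> * (\<xi> \<bullet> x))) = 0" for \<xi>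
    proof -
      have "(CLINT x|lborel. c x * exp (- \<i> * (\<xi> \<bullet> x))) = (CLINT x|lborel. G x (a + b) * exp (- \<i> * (\<xi> \<bullet> x)))"
        unfolding conv(3) kernel_fourier[OF a] kernel_fourier[OF b] kernel_fourier[OF ab]
        by (simp add: algebra_simps flip: exp_add of_real_mult)
      then show ?thesis
        using integrable_mult_character[OF conv(1)] integrable_mult_character[OF kernel_integrable[OF ab]] by (simp add: left_diff_distrib)
    qed
    show "0 < r - s" using s by simp
    show "0 < min d e" using d e by simp
    show "AE y in lborel. y \<in> ball x (min d e) \<longrightarrow> r - s \<le> c y - G y (a + b)"
      using conv(2)
    proof eventually_elim
      case (elim y)
      \<comment> \<open>Integrability at almost every \<open>y\<close> identifies the Bochner
        integral \<open>c y\<close> with the nonnegative integral, for which semicontinuity was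
        shown.\<close>
      have "ennreal (c y) = (\<integral>\<^sup>+ z. ennreal (G (y - z) a * G z b) \<partial>lborel)"
        using nn_integral_eq_integral[OF elim] kernel_pos[OF a] kernel_pos[OF b]
        by (simp add: c_def less_imp_le)
      then have "y \<in> ball x (min d e) \<Longrightarrow> ennreal r < ennreal (c y)"
        using d(2)[of y] r by simp
      moreover have "0 \<le> c y"
        unfolding c_def using kernel_pos[OF a] kernel_pos[OF b] by (intro integral_nonneg_AE) (simp add: less_imp_le)
      ultimately show ?case
        using e(2)[of y] r by (force simp: ennreal_less_iff)
    qed
  qed
qed

lemma kernel_semigroup:
  assumes a: "a > 0" and b: "b > 0"
  shows "AE z in lborel. (\<integral>\<^sup>+ y. ennreal (G (x - y) a) * ennreal (G (y - z) b) \<partial>lborel) = ennreal (G (x - z) (a + b))"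
proof -
  have ab: "a + b > 0" using a b by simp
  note [measurable] = kernel_measurable[OF a] kernel_measurable[OF b] kernel_measurable[OF ab]
  define f where "f z = (\<integral>\<^sup>+ y. ennreal (G (x - y) a) * ennreal (G (y - z) b) \<partial>lborel)" for z
  have [measurable]: "f \<in> borel_measurable borel" unfolding f_def by measurable
  have le: "f z \<le> ennreal (G (x - z) (a + b))" for z
  proof -
    have "f z = (\<integral>\<^sup>+ y. ennreal (G (x - z - y) a * G y b) \<partial>lborel)"
      using nn_integral_translate(1)[of "\<lambda>y. ennreal (G (x - y) a) * ennreal (G (y - z) b)" z] kernel_pos[OF a] kernel_pos[OF b]
      by (simp add: f_def ennreal_mult less_imp_le algebra_simps)
    then show ?thesis using kernel_convolution_le[OF a b] by simp
  qed
  have "(\<integral>\<^sup>+ z. f z \<partial>lborel) = (\<integral>\<^sup>+ y. \<integral>\<^sup>+ z. ennreal (G (x - y) a) * ennreal (G (y - z) b) \<partial>lborel \<partial>lborel)"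
    unfolding f_def by (rule lborel_pair.Fubini') measurable
  also have "\<dots> = 1"
    using nn_integral_translate(2)[of "\<lambda>z. ennreal (G z a)" x] nn_integral_translate(2)[of "\<lambda>z. ennreal (G z b)"]
    by (simp add: nn_integral_cmult kernel_nn_integral a b)
  finally have f1: "(\<integral>\<^sup>+ z. f z \<partial>lborel) = 1" .
  moreover have g1: "(\<integral>\<^sup>+ z. ennreal (G (x - z) (a + b)) \<partial>lborel) = 1"
    using nn_integral_translate(2)[of "\<lambda>z. ennreal (G z (a + b))" x] by (simp add: kernel_nn_integral ab)
  ultimately have "(\<integral>\<^sup>+ z. ennreal (G (x - z) (a + b)) - f z \<partial>lborel) = 0"
    using le by (subst nn_integral_diff) auto
  then have "AE z in lborel. ennreal (G (x - z) (a + b)) - f z = 0"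
    by (simp add: nn_integral_0_iff_AE)
  then show ?thesis
  proof eventually_elim
    case (elim z)
    then have "ennreal (G (x - z) (a + b)) \<le> f z" using ennreal_minus_eq_0 by blast
    then show ?case using le[of z] unfolding f_def by (rule antisym[rotated])
  qed
qed

end

text \<open>Dilation by \<open>l\<close> divides frequencies by \<open>l\<close>, and the factor
  \<open>l powr \<theta>\<close> in time compensates, so both sides have the same transform.
  Allowing two kernels gives self-similarity and, with \<open>l = 1\<close>, uniqueness at
  once.\<close>

lemma kernel_scaling:
  fixes G G' :: "real ^ 'n \<Rightarrow> real \<Rightarrow> real"
  assumes G: "fundamental_solution \<theta> G" and G': "fundamental_solution \<theta> G'" and l: "l > 0" and t: "t > 0"
  shows "G' x t = l ^ CARD('n) * G (l *\<^sub>R x) (l powr \<theta> * t)"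
proof -
  define s where "s = l powr \<theta> * t"
  have s: "s > 0" using l t by (simp add: s_def)
  have "(\<lambda>x. G' x t) = (\<lambda>x. l ^ DIM(real ^ 'n) * G (l *\<^sub>R x) s)"
  proof (rule continuous_eq_if_fourier_eq)
    show "integrable lborel (\<lambda>x. G' x t)" "continuous_on UNIV (\<lambda>x. G' x t)"
      using kernel_integrable[OF G' t] kernel_continuous_slice[OF G' t] .
    show "integrable lborel (\<lambda>x. l ^ DIM(real ^ 'n) * G (l *\<^sub>R x) s)"
      by (rule fourier_scaling(1)[OF l kernel_integrable[OF G s]])
    show "continuous_on UNIV (\<lambda>x. l ^ DIM(real ^ 'n) * G (l *\<^sub>R x) s)"
      using continuous_on_compose2[OF kernel_continuous_slice[OF G s], of UNIV "\<lambda>x. l *\<^sub>R x"]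
      by (simp add: continuous_on_mult_left continuous_on_scaleR)
    have "s * norm (\<xi> /\<^sub>R l) powr \<theta> = t * norm \<xi> powr \<theta>" for \<xi> :: "real ^ 'n"
    proof -
      have "norm (\<xi> /\<^sub>R l) = norm \<xi> / l" using l by (simp add: field_simps)
      then show ?thesis using l by (simp add: s_def powr_divide)
    qed
    then show "(CLINT x|lborel. G' x t * exp (- \<i> * (\<xi> \<bullet> x))) =
        (CLINT x|lborel. (l ^ DIM(real ^ 'n) * G (l *\<^sub>R x) s) * exp (- \<i> * (\<xi> \<bullet> x)))" for \<xi>
      unfolding fourier_scaling(2)[OF l kernel_integrable[OF G s]] kernel_fourier[OF G s] kernel_fourier[OF G' t]
      by simp
  qed
  then show ?thesis by (simp add: s_def fun_eq_iff)
qed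

section \<open>The integral equation\<close>

text \<open>The cutoff at nonpositive times, where \<open>G\<close> is unconstrained, makes the
  kernel Borel measurable on all of space-time, so that Tonelli's theorem applies without
  restricting the domain.\<close>

definition heat_kernel :: "(real ^ 'n \<Rightarrow> real \<Rightarrow> real) \<Rightarrow> (real ^ 'n) \<times> real \<Rightarrow> ennreal" where
  "heat_kernel G = (\<lambda>(x, t). if t > 0 then ennreal (G x t) else 0)"

definition heat_op :: "(real ^ 'n \<Rightarrow> real \<Rightarrow> real) \<Rightarrow> real \<Rightarrow> (real ^ 'n \<Rightarrow> ennreal) \<Rightarrow> real ^ 'n \<Rightarrow> ennreal" where
  "heat_op G t f x = (\<integral>\<^sup>+ y. heat_kernel G (x - y, t) * f y \<partial>lborel)"

lemma measurable_heat_kernel: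
  assumes "fundamental_solution \<theta> G"
  shows "heat_kernel G \<in> borel_measurable (borel \<Otimes>\<^sub>M borel)"
proof -
  have "(\<lambda>z. indicator (UNIV \<times> {0<..}) z *\<^sub>R (\<lambda>(x, t). G x t) z) \<in> borel_measurable borel"
    by (rule borel_measurable_continuous_on_indicator[OF _ kernel_continuous[OF assms]])
       (intro borel_open open_Times open_UNIV open_greaterThan)
  then have "(\<lambda>z. ennreal (indicator (UNIV \<times> {0<..}) z *\<^sub>R (\<lambda>(x, t). G x t) z)) \<in> borel_measurable borel"
    by measurable
  also have "(\<lambda>z. ennreal (indicator (UNIV \<times> {0<..}) z *\<^sub>R (\<lambda>(x, t). G x t) z)) = heat_kernel G"
    by (auto simp: heat_kernel_def indicator_def fun_eq_iff)
  finally show ?thesis by (simp add: borel_prod)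
qed

section \<open>Almost everywhere statements on product spaces\<close>

lemma AE_lborel_pair:
  fixes P :: "'a::euclidean_space \<times> 'b::euclidean_space \<Rightarrow> bool"
  assumes "AE z in lborel. P z"
  shows "AE x in lborel. AE y in lborel. P (x, y)" and "AE y in lborel. AE x in lborel. P (x, y)"
proof -
  have *: "AE z in (lborel \<Otimes>\<^sub>M lborel). P z" using assms unfolding lborel_prod .
  show "AE x in lborel. AE y in lborel. P (x, y)"
    by (rule lborel_pair.AE_pair[OF *])
  \<comment> \<open>\<open>P\<close> need not be measurable, so the quantifiers are exchanged for a
    measurable null set containing the exceptional set.\<close>
  obtain N where N: "N \<in> null_sets (lborel \<Otimes>\<^sub>M lborel)" "{z \<in> space (lborel \<Otimes>\<^sub>M lborel). \<not> P z} \<subseteq> N"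
    using * unfolding eventually_ae_filter by blast
  have "AE z in (lborel \<Otimes>\<^sub>M lborel). z \<notin> N" using N(1) by (rule AE_not_in)
  then have "AE x in lborel. AE y in lborel. (x, y) \<notin> N" by (rule lborel_pair.AE_pair)
  moreover have "{z \<in> space (lborel \<Otimes>\<^sub>M lborel :: ('a \<times> 'b) measure). (fst z, snd z) \<notin> N} \<in> sets (lborel \<Otimes>\<^sub>M lborel)"
  proof -
    have [measurable]: "N \<in> sets (lborel \<Otimes>\<^sub>M lborel)" using N(1) by (rule null_setsD2)
    show ?thesis by measurable
  qed
  ultimately have "AE y in lborel. AE x in lborel. (x, y) \<notin> N"
    by (subst (asm) lborel_pair.AE_commute) auto
  then show "AE y in lborel. AE x in lborel. P (x, y)"
  proof eventually_elim
    case (elim y)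
    then show ?case by eventually_elim (use N(2) in \<open>auto simp: space_pair_measure\<close>)
  qed
qed

lemma AE_lborel_pairI:
  fixes P :: "'a::euclidean_space \<times> 'b::euclidean_space \<Rightarrow> bool"
  assumes "Measurable.pred (borel \<Otimes>\<^sub>M borel) P" and "AE x in lborel. AE y in lborel. P (x, y)"
  shows "AE z in lborel. P z"
proof -
  have "{z \<in> space (lborel \<Otimes>\<^sub>M lborel). P z} \<in> sets (lborel \<Otimes>\<^sub>M lborel)"
    using assms(1) by (simp add: pred_def sets_pair_measure_cong[OF sets_lborel sets_lborel] space_pair_measure)
  then show ?thesis
    using lborel_pair.AE_pair_measure[of P] assms(2) unfolding lborel_prod by simp
qed

section \<open>The semigroup action and the blow-up bound\<close>

context
  fixes \<theta> :: real and G :: "real ^ 'n \<Rightarrow> real \<Rightarrow> real"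
  assumes G: "fundamental_solution \<theta> G"
begin

text \<open>Tonelli brings the two kernels together; their convolution identity holds for almost
  every \<open>z\<close>, which suffices under the integral.\<close>

lemma heat_op_semigroup:
  assumes a: "a > 0" and b: "b > 0" and [measurable]: "f \<in> borel_measurable borel"
  shows "heat_op G a (heat_op G b f) x = heat_op G (a + b) f x"
proof -
  note [measurable] = kernel_measurable[OF G a] kernel_measurable[OF G b]
  have "heat_op G a (heat_op G b f) x =
    (\<integral>\<^sup>+ y. \<integral>\<^sup>+ z. ennreal (G (x - y) a) * (ennreal (G (y - z) b) * f z) \<partial>lborel \<partial>lborel)"
    using a b by (simp add: heat_op_def heat_kernel_def nn_integral_cmult)
  also have "\<dots> = (\<integral>\<^sup>+ z. \<integral>\<^sup>+ y. ennreal (G (x - y) a) * (ennreal (G (y - z) b) * f z) \<partial>lborel \<partial>lborel)"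
    by (rule lborel_pair.Fubini') measurable
  also have "\<dots> = (\<integral>\<^sup>+ z. (\<integral>\<^sup>+ y. ennreal (G (x - y) a) * ennreal (G (y - z) b) \<partial>lborel) * f z \<partial>lborel)"
    by (simp add: nn_integral_multc[symmetric] mult.assoc)
  also have "\<dots> = (\<integral>\<^sup>+ z. ennreal (G (x - z) (a + b)) * f z \<partial>lborel)"
    by (rule nn_integral_cong_AE) (use kernel_semigroup[OF G a b, of x] in eventually_elim, simp)
  finally show ?thesis using a b by (simp add: heat_op_def heat_kernel_def)
qed

lemma heat_op_jensen:
  assumes a: "a > 0" and p: "p > 1" and [measurable]: "f \<in> borel_measurable borel"
    and fin: "heat_op G a f x < \<infinity>"
  shows "ennreal_powr (heat_op G a f x) p \<le> heat_op G a (\<lambda>y. ennreal_powr (f y) p) x"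
proof -
  note [measurable] = kernel_measurable[OF G a]
  have "(\<integral>\<^sup>+ y. ennreal (G (x - y) a) \<partial>lborel) = 1"
    using nn_integral_translate(2)[of "\<lambda>y. ennreal (G y a)" x] kernel_nn_integral[OF G a] by simp
  then show ?thesis
    using fin a p unfolding heat_op_def heat_kernel_def
    by (auto intro!: jensen_ennreal_powr)
qed

text \<open>Both orders of quantifiers enter. \<open>P2\<close> fixes \<open>(x, t)\<close> and
  gives the equation from almost every starting time, hence finiteness of \<open>w\<close>.
  \<open>P1\<close> gives the equation at time \<open>s\<close> for almost every \<open>y\<close>,
  so that it can be integrated against the kernel centred at \<open>x\<close>.\<close>

lemma heat_op_blowup_bound:
  fixes v :: "(real ^ 'n) \<times> real \<Rightarrow> ennreal" and p T :: real
  assumes p: "p > 1" and v[measurable]: "v \<in> borel_measurable (borel \<Otimes>\<^sub>M borel)"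
  defines "P \<equiv> \<lambda>x \<tau> t. 0 < \<tau> \<and> \<tau> < t \<and> t < T \<longrightarrow> v (x, t) < \<infinity> \<and>
      v (x, t) = heat_op G (t - \<tau>) (\<lambda>y. v (y, \<tau>)) x +
        (\<integral>\<^sup>+ s\<in>{\<tau><..<t}. heat_op G (t - s) (\<lambda>y. ennreal_powr (v (y, s)) p) x \<partial>lborel)"
  assumes P1: "AE \<tau> in lborel. AE t in lborel. AE x in lborel. P x \<tau> t"
    and P2: "AE x in lborel. AE t in lborel. AE \<tau> in lborel. P x \<tau> t"
  shows "AE \<tau> in lborel. AE t in lborel. AE x in lborel. 0 < \<tau> \<and> \<tau> < t \<and> t < T \<longrightarrow>
    heat_op G (t - \<tau>) (\<lambda>y. v (y, \<tau>)) x \<le> ennreal (((1 - 2 powr (1 - p)) * (t - \<tau>)) powr (- 1 / (p - 1)))"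
proof -
  note [measurable] = measurable_heat_kernel[OF G]
  define B where "B = (\<lambda>(x, t, \<tau>). 0 < \<tau> \<and> \<tau> < t \<and> t < T \<longrightarrow>
    heat_op G (t - \<tau>) (\<lambda>y. v (y, \<tau>)) x \<le> ennreal (((1 - 2 powr (1 - p)) * (t - \<tau>)) powr (- 1 / (p - 1))))"
  have "AE \<tau> in lborel. B (x, t, \<tau>)" if xt: "AE \<tau> in lborel. P x \<tau> t" for x t
    using P1
  proof eventually_elim
    case (elim \<tau>)
    define w where "w s = heat_op G (t - s) (\<lambda>y. v (y, s)) x" for s
    have w_meas: "w \<in> borel_measurable borel"
      unfolding w_def heat_op_def by measurable
    \<comment> \<open>Dropping the nonnegative source term in the equation leaves
      \<open>w s \<le> v (x, t)\<close>.\<close>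
    have w_fin: "w s < \<infinity>" if "P x s t" "0 < s" "s < t" "t < T" for s
    proof -
      have "w s \<le> v (x, t)" using that unfolding P_def w_def by auto
      also have "\<dots> < \<infinity>" using that unfolding P_def by auto
      finally show ?thesis .
    qed
    have "w \<tau> \<le> ennreal (((1 - 2 powr (1 - p)) * (t - \<tau>)) powr (- 1 / (p - 1)))"
      if \<tau>: "0 < \<tau>" "\<tau> < t" "t < T"
    proof (rule integral_inequality_bound[OF p \<tau>(2) w_meas])
      show "AE s in lborel. \<tau> < s \<and> s < t \<longrightarrow>
        w s < \<infinity> \<and> w \<tau> + (\<integral>\<^sup>+ r\<in>{\<tau><..<s}. ennreal_powr (w r) p \<partial>lborel) \<le> w s"
        using elim xt
      proof eventually_elim
        case (elim s)
        show ?case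
        proof (intro impI conjI)
          assume s: "\<tau> < s \<and> s < t"
          then show "w s < \<infinity>" using w_fin elim(2) \<tau> by auto
          let ?V = "\<lambda>r y. ennreal_powr (v (y, r)) p"
          have "(\<integral>\<^sup>+ r\<in>{\<tau><..<s}. ennreal_powr (w r) p \<partial>lborel) \<le> (\<integral>\<^sup>+ r\<in>{\<tau><..<s}. heat_op G (t - r) (?V r) x \<partial>lborel)"
          proof (rule nn_integral_mono_AE, use xt in eventually_elim)
            case (elim r)
            show ?case
            proof (cases "r \<in> {\<tau><..<s}")
              case True
              then have "w r < \<infinity>" using w_fin[OF elim] s \<tau> by auto
              then have "ennreal_powr (w r) p \<le> heat_op G (t - r) (?V r) x"
                unfolding w_def using True s p by (intro heat_op_jensen) auto
              then show ?thesis using True by simp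
            qed auto
          qed
          \<comment> \<open>The operator at time \<open>t - r\<close> is split at the intermediate
            time \<open>s\<close>. After Tonelli, \<open>heat_op G (t - s)\<close> can be pulled
            out, and inside remains the right side of the equation on \<open>(\<tau>, s)\<close>,
            which is \<open>v\<close> at time \<open>s\<close>.\<close>
          also have "\<dots> = (\<integral>\<^sup>+ r\<in>{\<tau><..<s}. heat_op G (t - s) (heat_op G (s - r) (?V r)) x \<partial>lborel)"
            using s by (intro nn_integral_cong) (auto simp: indicator_def heat_op_semigroup)
          also have "\<dots> = (\<integral>\<^sup>+ r. \<integral>\<^sup>+ y. heat_kernel G (x - y, t - s) * (heat_op G (s - r) (?V r) y * indicator {\<tau><..<s} r) \<partial>lborel \<partial>lborel)"
            unfolding heat_op_def[of G "t - s"] mult.assoc[symmetric]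
            by (subst nn_integral_multc) (auto simp: heat_op_def)
          also have "\<dots> = (\<integral>\<^sup>+ y. \<integral>\<^sup>+ r. heat_kernel G (x - y, t - s) * (heat_op G (s - r) (?V r) y * indicator {\<tau><..<s} r) \<partial>lborel \<partial>lborel)"
            unfolding heat_op_def by (rule lborel_pair.Fubini') measurable
          also have "\<dots> = heat_op G (t - s) (\<lambda>y. \<integral>\<^sup>+ r\<in>{\<tau><..<s}. heat_op G (s - r) (?V r) y \<partial>lborel) x"
            unfolding heat_op_def[of G "t - s"] by (subst nn_integral_cmult) (auto simp: heat_op_def)
          finally have "w \<tau> + (\<integral>\<^sup>+ r\<in>{\<tau><..<s}. ennreal_powr (w r) p \<partial>lborel) \<le>
            heat_op G (t - s) (heat_op G (s - \<tau>) (\<lambda>y. v (y, \<tau>))) x +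
            heat_op G (t - s) (\<lambda>y. \<integral>\<^sup>+ r\<in>{\<tau><..<s}. heat_op G (s - r) (?V r) y \<partial>lborel) x"
            using s by (intro add_mono) (auto simp: heat_op_semigroup w_def)
          also have "\<dots> = heat_op G (t - s) (\<lambda>y. heat_op G (s - \<tau>) (\<lambda>y. v (y, \<tau>)) y +
              (\<integral>\<^sup>+ r\<in>{\<tau><..<s}. heat_op G (s - r) (?V r) y \<partial>lborel)) x"
            unfolding heat_op_def distrib_left by (rule nn_integral_add[symmetric]) measurable
          also have "\<dots> = w s"
            unfolding w_def heat_op_def[of G "t - s"]
            by (rule nn_integral_cong_AE, use elim(1) in eventually_elim) (use s \<tau> in \<open>auto simp: P_def\<close>)
          finally show "w \<tau> + (\<integral>\<^sup>+ r\<in>{\<tau><..<s}. ennreal_powr (w r) p \<partial>lborel) \<le> w s" .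
        qed
      qed
    qed
    then show ?case by (auto simp: B_def w_def)
  qed
  note B_AE = this
  \<comment> \<open>\<open>B\<close> is obtained with \<open>x\<close> outermost and
    \<open>\<tau>\<close> innermost, the reverse of the claim. Measurability turns this into a
    statement on triples, which is then unrolled in the other order.\<close>
  have B: "Measurable.pred (borel \<Otimes>\<^sub>M (borel \<Otimes>\<^sub>M borel)) B"
  proof -
    define h :: "(real ^ 'n) \<times> real \<times> real \<Rightarrow> ennreal"
      where "h z = heat_op G (fst (snd z) - snd (snd z)) (\<lambda>y. v (y, snd (snd z))) (fst z)" for z
    define k :: "(real ^ 'n) \<times> real \<times> real \<Rightarrow> ennreal"
      where "k z = ennreal (((1 - 2 powr (1 - p)) * (fst (snd z) - snd (snd z))) powr (- 1 / (p - 1)))" for z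
    have [measurable]: "h \<in> borel_measurable (borel \<Otimes>\<^sub>M (borel \<Otimes>\<^sub>M borel))"
      unfolding h_def heat_op_def by measurable
    have [measurable]: "k \<in> borel_measurable (borel \<Otimes>\<^sub>M (borel \<Otimes>\<^sub>M borel))"
      unfolding k_def by measurable
    have "B = (\<lambda>z. 0 < snd (snd z) \<and> snd (snd z) < fst (snd z) \<and> fst (snd z) < T \<longrightarrow> h z \<le> k z)"
      by (auto simp: B_def h_def k_def)
    also have "Measurable.pred (borel \<Otimes>\<^sub>M (borel \<Otimes>\<^sub>M borel)) \<dots>"
      by measurable
    finally show ?thesis .
  qed
  have "AE x in lborel. AE q in lborel. B (x, q)"
    using P2
  proof eventually_elim
    case (elim x)
    have "Measurable.pred (borel \<Otimes>\<^sub>M borel) (\<lambda>q. B (x, q))"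
      by (rule measurable_compose[OF measurable_Pair1' B]) simp
    moreover have "AE t in lborel. AE \<tau> in lborel. B (x, t, \<tau>)"
      using elim by eventually_elim (rule B_AE)
    ultimately show ?case by (rule AE_lborel_pairI)
  qed
  then have "AE z in lborel. B z"
    using B by (intro AE_lborel_pairI) (simp_all add: borel_prod)
  then have "AE q in lborel. AE x in lborel. B (x, q)"
    by (rule AE_lborel_pair)
  then have "AE \<tau> in lborel. AE t in lborel. AE x in lborel. B (x, t, \<tau>)"
    by (rule AE_lborel_pair(2))
  then show ?thesis unfolding B_def by simp
qed

end

section \<open>The kernel on parabolic neighbourhoods and the ball averages\<close>

lemma kernel_lower_bound:
  fixes G\<^sub>0 :: "real ^ 'n \<Rightarrow> real \<Rightarrow> real"
  assumes G\<^sub>0: "fundamental_solution \<theta> G\<^sub>0"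
  obtains m where "m > 0"
    "\<And>G z r a. \<lbrakk>fundamental_solution \<theta> G; r > 0; norm z \<le> 2 * r; r powr \<theta> / 2 \<le> a; a \<le> r powr \<theta>\<rbrakk>
      \<Longrightarrow> m / r ^ CARD('n) \<le> G (z :: real ^ 'n) a"
proof -
  \<comment> \<open>Rescaling by \<open>r\<close> sends the admissible \<open>(z, a)\<close> into
    this compact set, where the kernel has a positive minimum. The radius 2 accounts for differences
    of two points of a unit ball.\<close>
  let ?K = "cball (0 :: real ^ 'n) 2 \<times> {1 / 2 .. 1 :: real}"
  have "compact ?K" by (intro compact_Times) auto
  moreover have "?K \<noteq> {}" by auto
  moreover have "continuous_on ?K (\<lambda>(x, t). G\<^sub>0 x t)"
    by (rule continuous_on_subset[OF kernel_continuous[OF G\<^sub>0]]) auto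
  ultimately obtain w where w: "w \<in> ?K" "\<And>z. z \<in> ?K \<Longrightarrow> (\<lambda>(x, t). G\<^sub>0 x t) w \<le> (\<lambda>(x, t). G\<^sub>0 x t) z"
    using continuous_attains_inf[of ?K "\<lambda>(x, t). G\<^sub>0 x t"] by blast
  define m where "m = (\<lambda>(x, t). G\<^sub>0 x t) w"
  have "m > 0" using w(1) kernel_pos[OF G\<^sub>0] by (auto simp: m_def)
  moreover have "m / r ^ CARD('n) \<le> G z a"
    if G: "fundamental_solution \<theta> G" and r: "r > 0" and z: "norm z \<le> 2 * r"
      and a: "r powr \<theta> / 2 \<le> a" "a \<le> r powr \<theta>" for G :: "real ^ 'n \<Rightarrow> real \<Rightarrow> real" and z r a
  proof -
    have rt: "r powr \<theta> > 0" using r by simp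
    then have a0: "a > 0" using a by linarith
    have l: "(1 / r) powr \<theta> = 1 / r powr \<theta>" using r by (simp add: powr_divide)
    have "((1 / r) *\<^sub>R z, (1 / r) powr \<theta> * a) \<in> ?K"
      unfolding l using z a r rt by (auto simp: field_simps)
    from w(2)[OF this] have "m \<le> G\<^sub>0 ((1 / r) *\<^sub>R z) ((1 / r) powr \<theta> * a)" by (simp add: m_def)
    \<comment> \<open>Scaling from \<open>G\<^sub>0\<close> to \<open>G\<close> makes the minimum of
      one kernel serve for all.\<close>
    moreover have "G z a = (1 / r) ^ CARD('n) * G\<^sub>0 ((1 / r) *\<^sub>R z) ((1 / r) powr \<theta> * a)"
      using r a0 by (intro kernel_scaling[OF G\<^sub>0 G]) auto
    ultimately show ?thesis using r by (simp add: field_simps power_divide)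
  qed
  ultimately show thesis by (rule that)
qed

text \<open>\<open>u\<close> is only Lebesgue measurable and its equation holds for almost all
  triples. A Borel version \<open>v\<close> makes Tonelli available, and the equation for
  \<open>v\<close> is derived in both iterated orders; the witness \<open>f\<close> is a time slice
  of \<open>v\<close>.\<close>

lemma solution_blowup_bound:
  fixes G :: "real ^ 'n \<Rightarrow> real \<Rightarrow> real"
  assumes p: "p > 1" and G: "fundamental_solution \<theta> G" and u: "is_solution G p T u"
  shows "AE \<tau> in lborel. 0 < \<tau> \<and> \<tau> < T \<longrightarrow>
    (\<exists>f\<in>borel_measurable borel. (AE y in lborel. u y \<tau> = f y) \<and>
      (AE t in lborel. AE x in lborel. \<tau> < t \<and> t < T \<longrightarrow>
        heat_op G (t - \<tau>) f x \<le> ennreal (((1 - 2 powr (1 - p)) * (t - \<tau>)) powr (- 1 / (p - 1)))))"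
proof -
  let ?\<Omega> = "UNIV \<times> {0<..<T} :: ((real ^ 'n) \<times> real) set"
  \<comment> \<open>Outside \<open>(0, T)\<close> nothing is known about \<open>u\<close>, so it is
    cut off to 0 before a Borel version is taken.\<close>
  have "(\<lambda>z. (case z of (x, t) \<Rightarrow> u x t) * indicator ?\<Omega> z) \<in> borel_measurable lebesgue"
  proof (subst borel_measurable_restrict_space_iff_ennreal[symmetric])
    have "?\<Omega> \<in> sets borel" by (intro borel_open open_Times open_UNIV open_greaterThanLessThan)
    then show "?\<Omega> \<inter> space lebesgue \<in> sets lebesgue" by simp
    show "(\<lambda>(x, t). u x t) \<in> borel_measurable (restrict_space lebesgue ?\<Omega>)"
      using u by (simp add: is_solution_def)
  qed
  from completion_ex_borel_measurable[OF this] obtain v where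
    v: "v \<in> borel_measurable lborel" "AE z in lborel. (case z of (x, t) \<Rightarrow> u x t) * indicator ?\<Omega> z = v z"
    by blast
  have v_meas: "v \<in> borel_measurable (borel \<Otimes>\<^sub>M borel)" using v(1) by (simp add: borel_prod)
  have uv: "AE x in lborel. AE t in lborel. 0 < t \<and> t < T \<longrightarrow> u x t = v (x, t)"
    "AE t in lborel. AE x in lborel. 0 < t \<and> t < T \<longrightarrow> u x t = v (x, t)"
    by (rule AE_lborel_pair[where P="\<lambda>(x, t). 0 < t \<and> t < T \<longrightarrow> u x t = v (x, t)", simplified],
        use v(2) in eventually_elim, auto)+
  have int_uv: "(\<integral>\<^sup>+ y. f y (u y s) \<partial>lborel) = (\<integral>\<^sup>+ y. f y (v (y, s)) \<partial>lborel)"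
    if "AE y in lborel. 0 < s \<and> s < T \<longrightarrow> u y s = v (y, s)" "0 < s" "s < T" for s and f :: "real ^ 'n \<Rightarrow> ennreal \<Rightarrow> ennreal"
    by (rule nn_integral_cong_AE, use that(1) in eventually_elim) (use that in auto)
  define P where "P x \<tau> t \<longleftrightarrow> (0 < \<tau> \<and> \<tau> < t \<and> t < T \<longrightarrow> v (x, t) < \<infinity> \<and>
      v (x, t) = heat_op G (t - \<tau>) (\<lambda>y. v (y, \<tau>)) x +
        (\<integral>\<^sup>+ s\<in>{\<tau><..<t}. heat_op G (t - s) (\<lambda>y. ennreal_powr (v (y, s)) p) x \<partial>lborel))" for x \<tau> t
  define Q where "Q = (\<lambda>(x, \<tau>, t). 0 < \<tau> \<and> \<tau> < t \<and> t < T \<longrightarrow>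
      u x t < \<infinity> \<and>
      u x t = (\<integral>\<^sup>+ y. ennreal (G (x - y) (t - \<tau>)) * u y \<tau> \<partial>lebesgue) +
        (\<integral>\<^sup>+ s\<in>{\<tau><..<t}. (\<integral>\<^sup>+ y. ennreal (G (x - y) (t - s)) * ennreal_powr (u y s) p \<partial>lebesgue) \<partial>lebesgue))"
  have Q: "AE z in lborel. Q z"
    using u by (simp add: is_solution_def Q_def AE_completion_iff)
  \<comment> \<open>The two extra premises handle the left side and the initial slice. The source
    term needs equality of \<open>u\<close> and \<open>v\<close> only on almost every time slice,
    which is \<open>uv(2)\<close>.\<close>
  have QP: "P x \<tau> t"
    if "Q (x, \<tau>, t)" "0 < t \<and> t < T \<longrightarrow> u x t = v (x, t)" "AE y in lborel. 0 < \<tau> \<and> \<tau> < T \<longrightarrow> u y \<tau> = v (y, \<tau>)" for x \<tau> t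
    unfolding P_def
  proof (intro impI)
    assume t: "0 < \<tau> \<and> \<tau> < t \<and> t < T"
    have 1: "(\<integral>\<^sup>+ y. ennreal (G (x - y) (t - \<tau>)) * u y \<tau> \<partial>lborel) = heat_op G (t - \<tau>) (\<lambda>y. v (y, \<tau>)) x"
      using int_uv[OF that(3), of "\<lambda>y a. ennreal (G (x - y) (t - \<tau>)) * a"] t
      by (simp add: heat_op_def heat_kernel_def)
    have 2: "(\<integral>\<^sup>+ s\<in>{\<tau><..<t}. (\<integral>\<^sup>+ y. ennreal (G (x - y) (t - s)) * ennreal_powr (u y s) p \<partial>lborel) \<partial>lborel) =
        (\<integral>\<^sup>+ s\<in>{\<tau><..<t}. heat_op G (t - s) (\<lambda>y. ennreal_powr (v (y, s)) p) x \<partial>lborel)"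
    proof (rule nn_integral_cong_AE, use uv(2) in eventually_elim)
      case (elim s)
      show ?case
        using int_uv[OF elim, of "\<lambda>y a. ennreal (G (x - y) (t - s)) * ennreal_powr a p"] t
        by (auto simp: heat_op_def heat_kernel_def indicator_def)
    qed
    show "v (x, t) < \<infinity> \<and> v (x, t) = heat_op G (t - \<tau>) (\<lambda>y. v (y, \<tau>)) x +
        (\<integral>\<^sup>+ s\<in>{\<tau><..<t}. heat_op G (t - s) (\<lambda>y. ennreal_powr (v (y, s)) p) x \<partial>lborel)"
    proof -
      have "u x t = v (x, t)" using that(2) t by auto
      from that(1)[unfolded Q_def prod.case, THEN mp, OF t] show ?thesis
        unfolding nn_integral_completion 1 2 \<open>u x t = v (x, t)\<close> .
    qed
  qed
  have "AE \<tau> in lborel. AE q in lborel. AE x in lborel. Q (x, \<tau>, q)"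
    using AE_lborel_pair(1)[OF AE_lborel_pair(2)[OF Q]] .
  then have P1: "AE \<tau> in lborel. AE t in lborel. AE x in lborel. P x \<tau> t"
    using uv(2)
  proof eventually_elim
    case (elim \<tau>)
    note \<tau> = elim(2)
    show ?case using elim(1) uv(2)
    proof eventually_elim
      case (elim t)
      then show ?case by eventually_elim (use QP \<tau> in blast)
    qed
  qed
  have "AE x in lborel. AE t in lborel. AE \<tau> in lborel. Q (x, \<tau>, t)"
    using AE_lborel_pair(1)[OF Q] by eventually_elim (rule AE_lborel_pair(2))
  then have P2: "AE x in lborel. AE t in lborel. AE \<tau> in lborel. P x \<tau> t"
    using uv(1)
  proof eventually_elim
    case (elim x)
    then show ?case
    proof eventually_elim
      case (elim t)
      note t = elim(2)
      show ?case using elim(1) uv(2) by eventually_elim (use QP t in blast)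
    qed
  qed
  have "AE \<tau> in lborel. AE t in lborel. AE x in lborel. 0 < \<tau> \<and> \<tau> < t \<and> t < T \<longrightarrow>
    heat_op G (t - \<tau>) (\<lambda>y. v (y, \<tau>)) x \<le> ennreal (((1 - 2 powr (1 - p)) * (t - \<tau>)) powr (- 1 / (p - 1)))"
    using P1 P2 unfolding P_def by (rule heat_op_blowup_bound[OF G p v_meas])
  then show ?thesis
    using uv(2)
  proof eventually_elim
    case (elim \<tau>)
    show ?case
    proof (intro impI bexI[of _ "\<lambda>y. v (y, \<tau>)"] conjI)
      show "(\<lambda>y. v (y, \<tau>)) \<in> borel_measurable borel"
        using v_meas by measurable
    qed (use elim in auto)
  qed
qed

lemma divide_le_if_scaled_le:
  assumes "ennreal (m / b) * I \<le> ennreal (a * (m * \<omega>))" "m > 0" "\<omega> > 0" "b > 0"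
  shows "I / ennreal (\<omega> * b) \<le> ennreal a"
proof (cases I)
  case (real i)
  with assms have "m / b * i \<le> a * (m * \<omega>) \<or> (m / b * i = 0 \<and> a * (m * \<omega>) \<le> 0)"
    by (cases "a \<ge> 0") (auto simp: ennreal_neg mult_nonpos_nonneg simp flip: ennreal_mult)
  then have "i / (\<omega> * b) \<le> a \<or> i = 0"
    using assms by (auto simp: field_simps)
  then show ?thesis
    using real assms by (auto simp: divide_ennreal ennreal_leI)
next
  case top
  then show ?thesis using assms by (simp add: ennreal_mult_top top_unique)
qed

theorem corollary1p1:
  fixes \<theta> p :: real
  assumes "0 < \<theta>" and "\<theta> \<le> 2" and "p > 1"
  shows "\<exists>\<gamma>::real. \<gamma> > 0 \<and>
    (\<forall>(G :: real ^ 'n \<Rightarrow> real \<Rightarrow> real) (T :: real) (u :: real ^ 'n \<Rightarrow> real \<Rightarrow> ennreal).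
       fundamental_solution \<theta> G \<longrightarrow> 0 < T \<longrightarrow> is_solution G p T u \<longrightarrow>
       (AE t in lebesgue. 0 < t \<and> t < T \<longrightarrow>
          (SUP x. (\<integral>\<^sup>+ y\<in>ball x ((T - t) powr (1 / \<theta>)). u y t \<partial>lebesgue)
                    / emeasure lebesgue (ball x ((T - t) powr (1 / \<theta>))))
          \<le> ennreal (\<gamma> * (T - t) powr (- 1 / (p - 1)))))"
proof (cases "\<exists>G\<^sub>0 :: real ^ 'n \<Rightarrow> real \<Rightarrow> real. fundamental_solution \<theta> G\<^sub>0")
  case False
  then show ?thesis by (intro exI[of _ 1]) auto
next
  case True
  \<comment> \<open>The constant must be fixed before \<open>G\<close>, so \<open>m\<close> comes
    from one chosen kernel; without any kernel the claim is vacuous.\<close>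
  then obtain G\<^sub>0 :: "real ^ 'n \<Rightarrow> real \<Rightarrow> real" where "fundamental_solution \<theta> G\<^sub>0" ..
  from kernel_lower_bound[OF this] obtain m where m: "m > 0"
    "\<And>G z r a. \<lbrakk>fundamental_solution \<theta> G; r > 0; norm z \<le> 2 * r; r powr \<theta> / 2 \<le> a; a \<le> r powr \<theta>\<rbrakk>
      \<Longrightarrow> m / r ^ CARD('n) \<le> G (z :: real ^ 'n) a" by blast
  define \<omega> where "\<omega> = unit_ball_vol (CARD('n))"
  have \<omega>: "\<omega> > 0" by (simp add: \<omega>_def)
  define \<kappa> :: real where "\<kappa> = 1 - 2 powr (1 - p)"
  have \<kappa>: "\<kappa> > 0" using \<open>p > 1\<close> by (simp add: \<kappa>_def powr_less_one)
  \<comment> \<open>The factor 1/2 reflects \<open>t - \<tau> > (T - \<tau>) / 2\<close> for the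
    auxiliary time \<open>t\<close> below; \<open>m * \<omega>\<close> comes from the kernel bound
    \<open>m / r ^ CARD('n)\<close> and the ball volume
    \<open>\<omega> * r ^ CARD('n)\<close>.\<close>
  define \<gamma> where "\<gamma> = (\<kappa> / 2) powr (- 1 / (p - 1)) / (m * \<omega>)"
  have "\<gamma> > 0" using m(1) \<omega> \<kappa> by (simp add: \<gamma>_def)
  moreover have "AE t in lebesgue. 0 < t \<and> t < T \<longrightarrow>
          (SUP x. (\<integral>\<^sup>+ y\<in>ball x ((T - t) powr (1 / \<theta>)). u y t \<partial>lebesgue)
                    / emeasure lebesgue (ball x ((T - t) powr (1 / \<theta>))))
          \<le> ennreal (\<gamma> * (T - t) powr (- 1 / (p - 1)))"
    if G: "fundamental_solution \<theta> G" and u: "is_solution G p T u"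
    for G :: "real ^ 'n \<Rightarrow> real \<Rightarrow> real" and T u
    unfolding AE_completion_iff using solution_blowup_bound[OF \<open>p > 1\<close> G u]
  proof eventually_elim
    \<comment> \<open>The time of the theorem is now \<open>\<tau>\<close>. Its exceptional set is
      fixed before \<open>x\<close>, so the supremum over all \<open>x\<close> adds no further null
      sets.\<close>
    case (elim \<tau>)
    show ?case
    proof (intro impI SUP_least)
      fix x :: "real ^ 'n" assume \<tau>: "0 < \<tau> \<and> \<tau> < T"
      define r where "r = (T - \<tau>) powr (1 / \<theta>)"
      have r: "r > 0" and r\<theta>: "r powr \<theta> = T - \<tau>"
        using \<tau> \<open>0 < \<theta>\<close> by (auto simp: r_def powr_powr)
      \<comment> \<open>For \<open>t\<close> in the second half of the interval,
        \<open>t - \<tau>\<close> lies between \<open>r powr \<theta> / 2\<close> and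
        \<open>r powr \<theta>\<close>, as the kernel bound requires.\<close>
      have "open {(T + \<tau>) / 2<..<T}" "{(T + \<tau>) / 2<..<T} \<noteq> {}" using \<tau> by auto
      moreover obtain f where f: "f \<in> borel_measurable borel" "AE y in lborel. u y \<tau> = f y"
        "AE t in lborel. AE x in lborel. \<tau> < t \<and> t < T \<longrightarrow>
          heat_op G (t - \<tau>) f x \<le> ennreal ((\<kappa> * (t - \<tau>)) powr (- 1 / (p - 1)))"
        using elim \<tau> unfolding \<kappa>_def by blast
      ultimately obtain t where t: "(T + \<tau>) / 2 < t" "t < T"
        "AE x in lborel. \<tau> < t \<and> t < T \<longrightarrow>
          heat_op G (t - \<tau>) f x \<le> ennreal ((\<kappa> * (t - \<tau>)) powr (- 1 / (p - 1)))"
        using AE_lborel_open_ex by (metis (no_types, lifting) greaterThanLessThan_iff)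
      have \<tau>t: "\<tau> < t" using t \<tau> by (simp add: field_simps)
      \<comment> \<open>The bound may fail at \<open>x\<close> itself, so a good point
        \<open>x'\<close> nearby is used; all of \<open>ball x r\<close> lies within distance
        \<open>2 * r\<close> of it.\<close>
      from AE_lborel_open_ex[OF t(3) open_ball, of x r] r obtain x' where x': "x' \<in> ball x r"
        "heat_op G (t - \<tau>) f x' \<le> ennreal ((\<kappa> * (t - \<tau>)) powr (- 1 / (p - 1)))"
        using \<tau> \<tau>t t(2) by auto
      have le: "ennreal (m / r ^ CARD('n)) * (f y * indicator (ball x r) y) \<le> heat_kernel G (x' - y, t - \<tau>) * f y" for y
      proof (cases "y \<in> ball x r")
        case True
        then have "norm (x' - y) \<le> 2 * r"
          using x'(1) dist_triangle[of x' y x] by (simp add: dist_norm[symmetric] dist_commute)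
        then have "m / r ^ CARD('n) \<le> G (x' - y) (t - \<tau>)"
          using r t \<tau> by (intro m(2) G) (auto simp: r\<theta> field_simps)
        then show ?thesis
          using True \<tau>t by (auto simp: heat_kernel_def intro!: mult_right_mono ennreal_leI)
      qed auto
      have uf: "(\<integral>\<^sup>+ y\<in>ball x r. u y \<tau> \<partial>lborel) = (\<integral>\<^sup>+ y\<in>ball x r. f y \<partial>lborel)"
        by (rule nn_integral_cong_AE, use f(2) in eventually_elim) simp
      have "ennreal (m / r ^ CARD('n)) * (\<integral>\<^sup>+ y\<in>ball x r. u y \<tau> \<partial>lborel) =
          (\<integral>\<^sup>+ y. ennreal (m / r ^ CARD('n)) * (f y * indicator (ball x r) y) \<partial>lborel)"
        unfolding uf using f(1) by (intro nn_integral_cmult[symmetric] borel_measurable_times_ennreal borel_measurable_indicator) auto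
      also have "\<dots> \<le> heat_op G (t - \<tau>) f x'"
        unfolding heat_op_def by (intro nn_integral_mono le)
      also have "\<dots> \<le> ennreal ((\<kappa> * (t - \<tau>)) powr (- 1 / (p - 1)))" by (rule x'(2))
      also have "\<dots> \<le> ennreal ((\<kappa> / 2 * (T - \<tau>)) powr (- 1 / (p - 1)))"
        using mult_left_mono[of "(T - \<tau>) / 2" "t - \<tau>" \<kappa>] t(1) \<tau> \<kappa> \<open>p > 1\<close>
        by (intro ennreal_leI powr_mono2') (auto simp: field_simps)
      also have "\<dots> = ennreal (\<gamma> * (T - \<tau>) powr (- 1 / (p - 1)) * (m * \<omega>))"
        using m(1) \<omega> \<kappa> \<tau> by (subst powr_mult) (simp_all add: \<gamma>_def)
      finally have "(\<integral>\<^sup>+ y\<in>ball x r. u y \<tau> \<partial>lborel) / ennreal (\<omega> * r ^ CARD('n))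
        \<le> ennreal (\<gamma> * (T - \<tau>) powr (- 1 / (p - 1)))"
        by (rule divide_le_if_scaled_le[OF _ m(1) \<omega> zero_less_power[OF r]])
      then show "(\<integral>\<^sup>+ y\<in>ball x ((T - \<tau>) powr (1 / \<theta>)). u y \<tau> \<partial>lebesgue)
          / emeasure lebesgue (ball x ((T - \<tau>) powr (1 / \<theta>)))
        \<le> ennreal (\<gamma> * (T - \<tau>) powr (- 1 / (p - 1)))"
        unfolding r_def[symmetric] nn_integral_completion
        using r by (simp add: emeasure_ball \<omega>_def)
    qed
  qed
  ultimately show ?thesis by blast
qed

end
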